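(* For every integer $n\ge 1$, $$\log^*n-\log^*\log^*n-1\;\le\; q_0(n)\;\le\;\log^*n+22.$$
   Context: Graphs are finite, simple, undirected, with non-empty vertex set. First order sentences about graphs use variables ranging over vertices, the relations $=$ and $\sim$ (adjacency), quantifiers $\forall,\exists$, connectives $\vee,\wedge,\neg$ and parentheses. A sentence $\Phi$ defines a graph $G$ if $\Phi$ is true on $G$ and false on every graph not isomorphic to $G$. The quantifier depth of a formula is the maximum number of nested quantifiers. A sentence is $0$-alternating if negations occur only directly in front of atomic formulas and no sequence of nested quantifiers contains a quantifier alternation (an occurrence of $\forall\exists$ or $\exists\forall$). $D_0(G)$ is the minimum quantifier depth of a $0$-alternating sentence defining $G$, and $q_0(n)=\min\{D_0(G): G \text{ a graph on } n \text{ vertices}\}$. $\log^*n$ is the minimum number of iterations of the binary logarithm needed to bring $n$ to $1$ or below (so $\log^* x=0$ for $x\le 1$). *)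

theory Defs
  imports Complex_Main "HOL-Library.Sublist" "Graph_Theory.Graph_Theory"
begin

text \<open>
  Vertices are natural numbers. Since every finite graph is isomorphic to one whose vertex set is
  a set of naturals, quantifying over these graphs amounts to quantifying over all finite graphs.
\<close>

definition simple_graph :: "nat pair_pre_digraph \<Rightarrow> bool" where
  "simple_graph G \<longleftrightarrow> pair_graph G \<and> pverts G \<noteq> {}"

datatype fo_formula =
    Eq nat nat
  | Adj nat nat
  | Neg fo_formula
  | Conj fo_formula fo_formula
  | Disj fo_formula fo_formula
  | ExQ nat fo_formula
  | AllQ nat fo_formula

primrec free_vars :: "fo_formula \<Rightarrow> nat set" where
  "free_vars (Eq x y) = {x, y}"
| "free_vars (Adj x y) = {x, y}"
| "free_vars (Neg \<phi>) = free_vars \<phi>"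
| "free_vars (Conj \<phi> \<psi>) = free_vars \<phi> \<union> free_vars \<psi>"
| "free_vars (Disj \<phi> \<psi>) = free_vars \<phi> \<union> free_vars \<psi>"
| "free_vars (ExQ x \<phi>) = free_vars \<phi> - {x}"
| "free_vars (AllQ x \<phi>) = free_vars \<phi> - {x}"

definition sentence :: "fo_formula \<Rightarrow> bool" where
  "sentence \<phi> \<longleftrightarrow> free_vars \<phi> = {}"

primrec sat :: "nat pair_pre_digraph \<Rightarrow> (nat \<Rightarrow> nat) \<Rightarrow> fo_formula \<Rightarrow> bool" where
  "sat G e (Eq x y) \<longleftrightarrow> e x = e y"
| "sat G e (Adj x y) \<longleftrightarrow> (e x, e y) \<in> parcs G"
| "sat G e (Neg \<phi>) \<longleftrightarrow> \<not> sat G e \<phi>"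
| "sat G e (Conj \<phi> \<psi>) \<longleftrightarrow> sat G e \<phi> \<and> sat G e \<psi>"
| "sat G e (Disj \<phi> \<psi>) \<longleftrightarrow> sat G e \<phi> \<or> sat G e \<psi>"
| "sat G e (ExQ x \<phi>) \<longleftrightarrow> (\<exists>v\<in>pverts G. sat G (e(x := v)) \<phi>)"
| "sat G e (AllQ x \<phi>) \<longleftrightarrow> (\<forall>v\<in>pverts G. sat G (e(x := v)) \<phi>)"

text \<open>For sentences the choice of the assignment is immaterial.\<close>

definition models :: "nat pair_pre_digraph \<Rightarrow> fo_formula \<Rightarrow> bool" where
  "models G \<phi> \<longleftrightarrow> (\<forall>e. range e \<subseteq> pverts G \<longrightarrow> sat G e \<phi>)"

lemma sat_cong:
  "(\<And>x. x \<in> free_vars \<phi> \<Longrightarrow> e x = e' x) \<Longrightarrow> sat G e \<phi> \<longleftrightarrow> sat G e' \<phi>"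
proof (induction \<phi> arbitrary: e e')
  case (Neg \<phi>)
  have "sat G e \<phi> = sat G e' \<phi>" by (rule Neg.IH) (use Neg.prems in auto)
  then show ?case by simp
next
  case (Conj \<phi> \<psi>)
  have "sat G e \<phi> = sat G e' \<phi>" by (rule Conj.IH(1)) (use Conj.prems in auto)
  moreover have "sat G e \<psi> = sat G e' \<psi>" by (rule Conj.IH(2)) (use Conj.prems in auto)
  ultimately show ?case by simp
next
  case (Disj \<phi> \<psi>)
  have "sat G e \<phi> = sat G e' \<phi>" by (rule Disj.IH(1)) (use Disj.prems in auto)
  moreover have "sat G e \<psi> = sat G e' \<psi>" by (rule Disj.IH(2)) (use Disj.prems in auto)
  ultimately show ?case by simp
next
  case (ExQ x \<phi>)
  have "sat G (e(x := v)) \<phi> = sat G (e'(x := v)) \<phi>" for v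
    by (rule ExQ.IH) (use ExQ.prems in auto)
  then show ?case by simp
next
  case (AllQ x \<phi>)
  have "sat G (e(x := v)) \<phi> = sat G (e'(x := v)) \<phi>" for v
    by (rule AllQ.IH) (use AllQ.prems in auto)
  then show ?case by simp
qed auto

lemma models_iff_sat:
  assumes "sentence \<phi>" "pverts G \<noteq> {}"
  shows "models G \<phi> \<longleftrightarrow> sat G e \<phi>"
proof -
  obtain v where "v \<in> pverts G" using assms by auto
  then have "range (\<lambda>_::nat. v) \<subseteq> pverts G" by auto
  moreover have "sat G e' \<phi> = sat G e \<phi>" for e'
    using assms(1) by (intro sat_cong) (simp add: sentence_def)
  ultimately show ?thesis unfolding models_def by blast
qed

definition defines_graph :: "fo_formula \<Rightarrow> nat pair_pre_digraph \<Rightarrow> bool" where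
  "defines_graph \<phi> G \<longleftrightarrow> models G \<phi> \<and>
    (\<forall>H. simple_graph H \<and> \<not> digraph_iso (with_proj H) (with_proj G) \<longrightarrow> \<not> models H \<phi>)"

primrec quantifier_depth :: "fo_formula \<Rightarrow> nat" where
  "quantifier_depth (Eq x y) = 0"
| "quantifier_depth (Adj x y) = 0"
| "quantifier_depth (Neg \<phi>) = quantifier_depth \<phi>"
| "quantifier_depth (Conj \<phi> \<psi>) = max (quantifier_depth \<phi>) (quantifier_depth \<psi>)"
| "quantifier_depth (Disj \<phi> \<psi>) = max (quantifier_depth \<phi>) (quantifier_depth \<psi>)"
| "quantifier_depth (ExQ x \<phi>) = Suc (quantifier_depth \<phi>)"
| "quantifier_depth (AllQ x \<phi>) = Suc (quantifier_depth \<phi>)"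

primrec neg_only_atoms :: "fo_formula \<Rightarrow> bool" where
  "neg_only_atoms (Eq x y) \<longleftrightarrow> True"
| "neg_only_atoms (Adj x y) \<longleftrightarrow> True"
| "neg_only_atoms (Neg \<phi>) \<longleftrightarrow> (\<exists>x y. \<phi> = Eq x y \<or> \<phi> = Adj x y)"
| "neg_only_atoms (Conj \<phi> \<psi>) \<longleftrightarrow> neg_only_atoms \<phi> \<and> neg_only_atoms \<psi>"
| "neg_only_atoms (Disj \<phi> \<psi>) \<longleftrightarrow> neg_only_atoms \<phi> \<and> neg_only_atoms \<psi>"
| "neg_only_atoms (ExQ x \<phi>) \<longleftrightarrow> neg_only_atoms \<phi>"
| "neg_only_atoms (AllQ x \<phi>) \<longleftrightarrow> neg_only_atoms \<phi>"

datatype quantifier = Exists | Forall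

text \<open>
  The maximal sequences of nested quantifiers: those met on the paths from the root of the syntax
  tree to its leaves.
\<close>

primrec quantifier_seqs :: "fo_formula \<Rightarrow> quantifier list set" where
  "quantifier_seqs (Eq x y) = {[]}"
| "quantifier_seqs (Adj x y) = {[]}"
| "quantifier_seqs (Neg \<phi>) = quantifier_seqs \<phi>"
| "quantifier_seqs (Conj \<phi> \<psi>) = quantifier_seqs \<phi> \<union> quantifier_seqs \<psi>"
| "quantifier_seqs (Disj \<phi> \<psi>) = quantifier_seqs \<phi> \<union> quantifier_seqs \<psi>"
| "quantifier_seqs (ExQ x \<phi>) = (#) Exists ` quantifier_seqs \<phi>"
| "quantifier_seqs (AllQ x \<phi>) = (#) Forall ` quantifier_seqs \<phi>"

definition zero_alternating :: "fo_formula \<Rightarrow> bool" where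
  "zero_alternating \<phi> \<longleftrightarrow> neg_only_atoms \<phi> \<and>
    (\<forall>s\<in>quantifier_seqs \<phi>. \<not> sublist [Forall, Exists] s \<and> \<not> sublist [Exists, Forall] s)"

text \<open>
  Every graph is defined by a zero-alternating sentence, namely the conjunction of an existential
  sentence listing its vertices and adjacencies and a universal one bounding the number of
  vertices. Hence the minima below are taken over non-empty sets (for the second one, if
  \<open>n \<ge> 1\<close>).
\<close>

definition D0 :: "nat pair_pre_digraph \<Rightarrow> nat" where
  "D0 G = (LEAST d. \<exists>\<phi>. sentence \<phi> \<and> zero_alternating \<phi> \<and> defines_graph \<phi> G \<and>
    quantifier_depth \<phi> = d)"

definition q0 :: "nat \<Rightarrow> nat" where
  "q0 n = (LEAST d. \<exists>G. simple_graph G \<and> card (pverts G) = n \<and> D0 G = d)"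

definition log_star :: "real \<Rightarrow> nat" where
  "log_star x = (LEAST k. (log 2 ^^ k) x \<le> 1)"

lemma log_star_le_1: "x \<le> 1 \<Longrightarrow> log_star x = 0"
  unfolding log_star_def by (rule Least_equality) auto

end

theory Submission
  imports Defs "HOL-Library.Nat_Bijection"
begin

text \<open>
  Upper bound. Suppose that every vertex \<open>w\<close> of \<open>G\<close> is the only one satisfying an existential formula
  \<open>\<tau>\<^sub>w\<close> of depth \<open>t\<close>. Then \<open>G\<close> is defined with depth \<open>t + 3\<close>: existential sentences say that each
  \<open>\<tau>\<^sub>w\<close> is realised, universal ones that realisations of \<open>\<tau>\<^sub>w\<close> and \<open>\<tau>\<^sub>w\<^sub>'\<close> are equal or adjacent
  exactly as \<open>w\<close> and \<open>w'\<close> are, and that no vertex differs from a realisation of every \<open>\<tau>\<^sub>w\<close>.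
  If all vertices of \<open>S\<close> are so identified, then one more quantifier identifies every vertex whose
  adjacencies to \<open>S\<close> are shared by no other vertex outside \<open>S\<close>, since non-adjacency to an
  identified vertex is an existential condition as well. Hence a rigid gadget followed by layers,
  each consisting of the non-empty subsets of the preceding one, has its size exponentiated at the
  price of one quantifier.

  Lower bound. A sentence of depth \<open>d\<close> without alternation that holds in \<open>G\<close> also holds in the
  subgraph induced by a set of witnesses which contains, for each chosen tuple and each type of a
  one-vertex extension, one extension of that type: universal parts are inherited by induced
  subgraphs, existential ones are witnessed. If the sentence defines \<open>G\<close>, then the witnesses are
  all of \<open>G\<close>, so the number of types bounds the order of \<open>G\<close> by a tower.
\<close>

section \<open>Graphs and existential formulas\<close>

lemma simple_graph_iff:
  "simple_graph G \<longleftrightarrow> finite (pverts G) \<and> pverts G \<noteq> {} \<and> parcs G \<subseteq> pverts G \<times> pverts G \<and>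
    sym (parcs G) \<and> irrefl (parcs G)"
proof
  assume "simple_graph G"
  then interpret pair_graph G by (simp add: simple_graph_def)
  have "symmetric (with_proj G)" by (rule pair_sym_arcs)
  then show "finite (pverts G) \<and> pverts G \<noteq> {} \<and> parcs G \<subseteq> pverts G \<times> pverts G \<and>
    sym (parcs G) \<and> irrefl (parcs G)"
    using \<open>simple_graph G\<close> pair_finite_verts in_arcsD1 in_arcsD2 pair_no_loops
    by (fastforce simp: simple_graph_def symmetric_def irrefl_def)
next
  assume *: "finite (pverts G) \<and> pverts G \<noteq> {} \<and> parcs G \<subseteq> pverts G \<times> pverts G \<and>
    sym (parcs G) \<and> irrefl (parcs G)"
  moreover from * have "finite (parcs G)"
    by (meson finite_SigmaI finite_subset)
  ultimately show "simple_graph G"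
    unfolding simple_graph_def
    by (intro conjI; unfold_locales) (auto simp: symmetric_def irrefl_def)
qed

text \<open>Library isomorphisms also act on arcs, heads and tails. As arcs are pairs of vertices,
  \<open>map_prod h h\<close>, \<open>snd\<close> and \<open>fst\<close> complete \<open>h\<close>
  to such an isomorphism.\<close>

lemma digraph_iso_with_proj:
  fixes G H :: "nat pair_pre_digraph"
  assumes "simple_graph H" "bij_betw h (pverts H) (pverts G)" "parcs G \<subseteq> pverts G \<times> pverts G"
    and adj: "\<And>u v. u \<in> pverts H \<Longrightarrow> v \<in> pverts H \<Longrightarrow> (h u, h v) \<in> parcs G \<longleftrightarrow> (u, v) \<in> parcs H"
  shows "digraph_iso (with_proj H) (with_proj G)"
proof -
  have H: "parcs H \<subseteq> pverts H \<times> pverts H" using assms(1) by (simp add: simple_graph_iff)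
  interpret pair_graph H using assms(1) by (simp add: simple_graph_def)
  define f :: "(nat, nat \<times> nat, nat, nat \<times> nat) digraph_isomorphism" where
    "f = \<lparr> iso_verts = h, iso_arcs = map_prod h h, iso_head = snd, iso_tail = fst \<rparr>"
  have inj: "inj_on h (pverts H)" and img: "h ` pverts H = pverts G"
    using assms(2) by (auto simp: bij_betw_def)
  have "inj_on (map_prod h h) (parcs H)"
    using inj H by (auto simp: inj_on_def subset_iff)
  then have "pre_digraph.digraph_isomorphism (with_proj H) f"
    using inj wf_digraph_axioms unfolding pre_digraph.digraph_isomorphism_def f_def
    by auto
  moreover have "parcs G = map_prod h h ` parcs H"
  proof (intro equalityI subsetI)
    fix e assume "e \<in> parcs G"
    then obtain u v where "e = (h u, h v)" "u \<in> pverts H" "v \<in> pverts H"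
      using assms(3) img by (cases e) blast
    then show "e \<in> map_prod h h ` parcs H" using adj \<open>e \<in> parcs G\<close> by force
  qed (use adj H in auto)
  then have "with_proj G = app_iso f (with_proj H)"
    using img by (simp add: app_iso_def f_def with_proj_def)
  ultimately show ?thesis unfolding digraph_iso_def by blast
qed

lemma card_pverts_digraph_iso:
  assumes "digraph_iso (with_proj H) (with_proj G)"
  shows "card (pverts G) = card (pverts H)"
proof -
  obtain f where f: "pre_digraph.digraph_isomorphism (with_proj H) f"
    "with_proj G = app_iso f (with_proj H)"
    using assms by (auto simp: digraph_iso_def)
  have "pverts G = iso_verts f ` pverts H"
    using arg_cong[OF f(2), of verts] by simp
  moreover have "inj_on (iso_verts f) (pverts H)"
    using pre_digraph.digraph_isomorphism_inj_on_verts[OF f(1)] by simp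
  ultimately show ?thesis by (simp add: card_image)
qed

section \<open>Existential formulas, their duals and formulas without alternation\<close>

primrec existential :: "fo_formula \<Rightarrow> bool" where
  "existential (Eq x y) \<longleftrightarrow> True"
| "existential (Adj x y) \<longleftrightarrow> True"
| "existential (Neg \<phi>) \<longleftrightarrow> (\<exists>x y. \<phi> = Eq x y \<or> \<phi> = Adj x y)"
| "existential (Conj \<phi> \<psi>) \<longleftrightarrow> existential \<phi> \<and> existential \<psi>"
| "existential (Disj \<phi> \<psi>) \<longleftrightarrow> existential \<phi> \<and> existential \<psi>"
| "existential (ExQ x \<phi>) \<longleftrightarrow> existential \<phi>"
| "existential (AllQ x \<phi>) \<longleftrightarrow> False"

text \<open>Negation pushed down to the atoms. It swaps the quantifiers, so universal formulas can
  be handled as duals of existential ones.\<close>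

primrec dual :: "fo_formula \<Rightarrow> fo_formula" where
  "dual (Eq x y) = Neg (Eq x y)"
| "dual (Adj x y) = Neg (Adj x y)"
| "dual (Neg \<phi>) = \<phi>"
| "dual (Conj \<phi> \<psi>) = Disj (dual \<phi>) (dual \<psi>)"
| "dual (Disj \<phi> \<psi>) = Conj (dual \<phi>) (dual \<psi>)"
| "dual (ExQ x \<phi>) = AllQ x (dual \<phi>)"
| "dual (AllQ x \<phi>) = ExQ x (dual \<phi>)"

lemma sat_dual [simp]: "sat G e (dual \<phi>) \<longleftrightarrow> \<not> sat G e \<phi>"
  by (induction \<phi> arbitrary: e) auto

lemma free_vars_dual [simp]: "free_vars (dual \<phi>) = free_vars \<phi>"
  by (induction \<phi>) auto

lemma quantifier_depth_dual [simp]: "quantifier_depth (dual \<phi>) = quantifier_depth \<phi>"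
  by (induction \<phi>) auto

lemma neg_only_atoms_dual: "neg_only_atoms \<phi> \<Longrightarrow> neg_only_atoms (dual \<phi>)"
  by (induction \<phi>) auto

lemma existential_imp_neg_only_atoms: "existential \<phi> \<Longrightarrow> neg_only_atoms \<phi>"
  by (induction \<phi>) auto

lemma existential_imp_seqs:
  "existential \<phi> \<Longrightarrow> s \<in> quantifier_seqs \<phi> \<Longrightarrow> set s \<subseteq> {Exists}"
  by (induction \<phi> arbitrary: s) fastforce+

lemma existential_imp_dual_seqs:
  "existential \<phi> \<Longrightarrow> s \<in> quantifier_seqs (dual \<phi>) \<Longrightarrow> set s \<subseteq> {Forall}"
  by (induction \<phi> arbitrary: s) fastforce+

text \<open>An \<open>AllQ\<close> above a subformula without sequences would leave no trace in
  \<open>quantifier_seqs\<close>. This rules that out in \<open>existentialI\<close>, and likewise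
  for \<open>ExQ\<close> in \<open>existential_dualI\<close>.\<close>

lemma quantifier_seqs_nonempty: "quantifier_seqs \<phi> \<noteq> {}"
  by (induction \<phi>) auto

lemma existentialI:
  "neg_only_atoms \<phi> \<Longrightarrow> (\<And>s. s \<in> quantifier_seqs \<phi> \<Longrightarrow> set s \<subseteq> {Exists}) \<Longrightarrow> existential \<phi>"
proof (induction \<phi>)
  case (AllQ x \<phi>)
  then show ?case using quantifier_seqs_nonempty[of \<phi>] by fastforce
qed fastforce+

lemma existential_dualI:
  "neg_only_atoms \<phi> \<Longrightarrow> (\<And>s. s \<in> quantifier_seqs \<phi> \<Longrightarrow> set s \<subseteq> {Forall}) \<Longrightarrow> existential (dual \<phi>)"
proof (induction \<phi>)
  case (ExQ x \<phi>)
  then show ?case using quantifier_seqs_nonempty[of \<phi>] by fastforce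
qed fastforce+

lemma not_sublist_alternation:
  assumes "set s \<subseteq> {q}" "a \<noteq> b"
  shows "\<not> sublist [a, b] s"
  using assms by (auto simp: sublist_def)

text \<open>\<open>sublist\<close> means contiguous sublist, so the leading \<open>Exists\<close>
  forces the next entry to be \<open>Exists\<close>, which then takes over its role.\<close>

lemma sublist_Cons_Exists_imp: 
  "\<not> sublist [Exists, Forall] (Exists # s) \<Longrightarrow> set s \<subseteq> {Exists}"
proof (induction s)
  case (Cons q s)
  have "q = Exists"
  proof (cases q)
    case Forall
    then have "sublist [Exists, Forall] (Exists # q # s)"
      by (auto simp: sublist_def intro: exI[of _ "[]"])
    then show ?thesis using Cons.prems by blast
  qed
  moreover have "\<not> sublist [Exists, Forall] (q # s)"
    using Cons.prems by (auto simp: sublist_Cons_right)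
  ultimately show ?case using Cons.IH by simp
qed simp

lemma sublist_Cons_Forall_imp:
  "\<not> sublist [Forall, Exists] (Forall # s) \<Longrightarrow> set s \<subseteq> {Forall}"
proof (induction s)
  case (Cons q s)
  have "q = Forall"
  proof (cases q)
    case Exists
    then have "sublist [Forall, Exists] (Forall # q # s)"
      by (auto simp: sublist_def intro: exI[of _ "[]"])
    then show ?thesis using Cons.prems by blast
  qed
  moreover have "\<not> sublist [Forall, Exists] (q # s)"
    using Cons.prems by (auto simp: sublist_Cons_right)
  ultimately show ?case using Cons.IH by simp
qed simp

lemma zero_alternating_existential: "existential \<phi> \<Longrightarrow> zero_alternating \<phi>"
  unfolding zero_alternating_def
  by (meson existential_imp_seqs existential_imp_neg_only_atoms not_sublist_alternation
      quantifier.distinct)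

lemma zero_alternating_dual: "existential \<phi> \<Longrightarrow> zero_alternating (dual \<phi>)"
  unfolding zero_alternating_def
  by (meson existential_imp_dual_seqs existential_imp_neg_only_atoms neg_only_atoms_dual
      not_sublist_alternation quantifier.distinct)

lemma zero_alternating_Conj [simp]:
  "zero_alternating (Conj \<phi> \<psi>) \<longleftrightarrow> zero_alternating \<phi> \<and> zero_alternating \<psi>"
  by (auto simp: zero_alternating_def)

lemma zero_alternating_Disj [simp]:
  "zero_alternating (Disj \<phi> \<psi>) \<longleftrightarrow> zero_alternating \<phi> \<and> zero_alternating \<psi>"
  by (auto simp: zero_alternating_def)

text \<open>Together with the version for \<open>AllQ\<close>, this splits a zero-alternating
  sentence into existential formulas and formulas with existential dual, joined by
  \<open>Conj\<close> and \<open>Disj\<close>.\<close>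

lemma zero_alternating_ExQ_imp:
  assumes "zero_alternating (ExQ x \<phi>)"
  shows "existential \<phi>"
proof (rule existentialI)
  show "neg_only_atoms \<phi>" using assms by (simp add: zero_alternating_def)
  show "set s \<subseteq> {Exists}" if "s \<in> quantifier_seqs \<phi>" for s
    using assms that by (intro sublist_Cons_Exists_imp) (auto simp: zero_alternating_def)
qed

lemma zero_alternating_AllQ_imp:
  assumes "zero_alternating (AllQ x \<phi>)"
  shows "existential (dual \<phi>)"
proof (rule existential_dualI)
  show "neg_only_atoms \<phi>" using assms by (simp add: zero_alternating_def)
  show "set s \<subseteq> {Forall}" if "s \<in> quantifier_seqs \<phi>" for s
    using assms that by (intro sublist_Cons_Forall_imp) (auto simp: zero_alternating_def)
qed

text \<open>There is no constant for truth, and a trivial equation may bring in a free variable;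
  hence the formula at the end of the conjunction is a parameter.\<close>

definition conj_list :: "fo_formula \<Rightarrow> fo_formula list \<Rightarrow> fo_formula" where
  "conj_list \<phi> \<phi>s = foldr Conj \<phi>s \<phi>"

lemma sat_conj_list [simp]:
  "sat G e (conj_list \<phi> \<phi>s) \<longleftrightarrow> sat G e \<phi> \<and> (\<forall>\<psi>\<in>set \<phi>s. sat G e \<psi>)"
  by (induction \<phi>s) (auto simp: conj_list_def)

lemma free_vars_conj_list [simp]:
  "free_vars (conj_list \<phi> \<phi>s) = free_vars \<phi> \<union> (\<Union>\<psi>\<in>set \<phi>s. free_vars \<psi>)"
  by (induction \<phi>s) (auto simp: conj_list_def)

lemma existential_conj_list [simp]:
  "existential (conj_list \<phi> \<phi>s) \<longleftrightarrow> existential \<phi> \<and> (\<forall>\<psi>\<in>set \<phi>s. existential \<psi>)"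
  by (induction \<phi>s) (auto simp: conj_list_def)

lemma zero_alternating_conj_list [simp]:
  "zero_alternating (conj_list \<phi> \<phi>s) \<longleftrightarrow> zero_alternating \<phi> \<and> (\<forall>\<psi>\<in>set \<phi>s. zero_alternating \<psi>)"
  by (induction \<phi>s) (auto simp: conj_list_def)

lemma quantifier_depth_conj_list_le [simp]:
  "quantifier_depth (conj_list \<phi> \<phi>s) \<le> d \<longleftrightarrow>
    quantifier_depth \<phi> \<le> d \<and> (\<forall>\<psi>\<in>set \<phi>s. quantifier_depth \<psi> \<le> d)"
  by (induction \<phi>s) (auto simp: conj_list_def)

section \<open>Definability by existential sentences and their negations\<close>

definition definable0 :: "nat \<Rightarrow> nat pair_pre_digraph \<Rightarrow> bool" where
  "definable0 d G \<longleftrightarrow> (\<exists>\<phi>. sentence \<phi> \<and> zero_alternating \<phi> \<and> defines_graph \<phi> G \<and>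
    quantifier_depth \<phi> \<le> d)"

lemma D0_le: "definable0 d G \<Longrightarrow> D0 G \<le> d"
  unfolding definable0_def D0_def by (elim exE conjE, rule le_trans, rule Least_le) auto

lemma definable0_D0: "definable0 d G \<Longrightarrow> definable0 (D0 G) G"
  unfolding definable0_def D0_def
  by (rule LeastI2_ex) auto

text \<open>Upper bounds are proved from existential sentences only: those in \<open>P\<close> are
  asserted, those in \<open>N\<close> are refuted through \<open>dual\<close>. The condition
  \<open>1 \<le> d\<close> pays for the initial conjunct \<open>ExQ 0 (Eq 0 0)\<close>.\<close>

lemma definable0I:
  assumes "pverts G \<noteq> {}" "1 \<le> d"
    and ex: "\<And>\<phi>. \<phi> \<in> set P \<union> set N \<Longrightarrow>
      existential \<phi> \<and> free_vars \<phi> = {} \<and> quantifier_depth \<phi> \<le> d"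
    and pos: "\<And>\<phi> e. \<phi> \<in> set P \<Longrightarrow> sat G e \<phi>"
    and neg: "\<And>\<phi> e. \<phi> \<in> set N \<Longrightarrow> \<not> sat G e \<phi>"
    and iso: "\<And>H. simple_graph H \<Longrightarrow> (\<And>\<phi> e. \<phi> \<in> set P \<Longrightarrow> sat H e \<phi>) \<Longrightarrow>
      (\<And>\<phi> e. \<phi> \<in> set N \<Longrightarrow> \<not> sat H e \<phi>) \<Longrightarrow> digraph_iso (with_proj H) (with_proj G)"
  shows "definable0 d G"
proof -
  define \<Phi> where "\<Phi> = conj_list (ExQ 0 (Eq 0 0)) (P @ map dual N)"
  have s: "sentence \<Phi>" using ex by (auto simp: sentence_def \<Phi>_def)
  have z: "zero_alternating \<Phi>"
    using ex by (auto simp: \<Phi>_def zero_alternating_existential zero_alternating_dual)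
  have q: "quantifier_depth \<Phi> \<le> d" using ex assms(2) by (auto simp: \<Phi>_def)
  have sat: "sat H e \<Phi> \<longleftrightarrow> pverts H \<noteq> {} \<and> (\<forall>\<phi>\<in>set P. sat H e \<phi>) \<and> (\<forall>\<phi>\<in>set N. \<not> sat H e \<phi>)" for H e
    by (auto simp: \<Phi>_def ball_Un)
  have "defines_graph \<Phi> G"
    unfolding defines_graph_def
  proof (intro conjI allI impI; (elim conjE)?)
    show "models G \<Phi>" using pos neg assms(1) by (auto simp: models_def sat)
  next
    fix H assume H: "simple_graph H" and ni: "\<not> digraph_iso (with_proj H) (with_proj G)"
    show "\<not> models H \<Phi>"
    proof
      assume "models H \<Phi>"
      moreover have "pverts H \<noteq> {}" using H by (simp add: simple_graph_iff)
      ultimately have "sat H e \<Phi>" for e using models_iff_sat[OF s, of H e] by blast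
      then have "digraph_iso (with_proj H) (with_proj G)" using H by (intro iso) (auto simp: sat)
      then show False using ni by blast
    qed
  qed
  then show ?thesis using s z q by (auto simp: definable0_def)
qed

section \<open>Identifying vertices by existential formulas\<close>

primrec ex_block :: "nat \<Rightarrow> fo_formula \<Rightarrow> fo_formula" where
  "ex_block 0 \<phi> = \<phi>"
| "ex_block (Suc m) \<phi> = ex_block m (ExQ m \<phi>)"

lemma sat_ex_block:
  "sat G e (ex_block m \<phi>) \<longleftrightarrow>
    (\<exists>f. (\<forall>i<m. f i \<in> pverts G) \<and> sat G (\<lambda>i. if i < m then f i else e i) \<phi>)"
proof (induction m arbitrary: \<phi>)
  case (Suc m)
  have upd: "(\<lambda>i. if i < m then f i else e i)(m := v) =
      (\<lambda>i. if i < Suc m then (f(m := v)) i else e i)" for f v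
    by (auto simp: fun_eq_iff less_Suc_eq)
  have "sat G e (ex_block (Suc m) \<phi>) \<longleftrightarrow>
    (\<exists>f. (\<forall>i<m. f i \<in> pverts G) \<and> (\<exists>v\<in>pverts G.
      sat G (\<lambda>i. if i < Suc m then (f(m := v)) i else e i) \<phi>))"
    unfolding ex_block.simps Suc.IH sat.simps upd ..
  also have "\<dots> \<longleftrightarrow> (\<exists>f. (\<forall>i<Suc m. f i \<in> pverts G) \<and> sat G (\<lambda>i. if i < Suc m then f i else e i) \<phi>)"
    (is "?L \<longleftrightarrow> ?R")
  proof
    assume ?L
    then obtain f v where "\<forall>i<m. f i \<in> pverts G" "v \<in> pverts G"
      "sat G (\<lambda>i. if i < Suc m then (f(m := v)) i else e i) \<phi>" by blast
    then show ?R by (intro exI[of _ "f(m := v)"]) auto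
  next
    assume ?R
    then obtain f where f: "\<forall>i<Suc m. f i \<in> pverts G"
      "sat G (\<lambda>i. if i < Suc m then f i else e i) \<phi>" by blast
    then have "sat G (\<lambda>i. if i < Suc m then (f(m := f m)) i else e i) \<phi>" unfolding fun_upd_triv by blast
    with f(1) show ?L by (intro exI[of _ f] conjI bexI[of _ "f m"]) simp_all
  qed
  finally show ?case .
qed simp

lemma free_vars_ex_block [simp]: "free_vars (ex_block m \<phi>) = free_vars \<phi> - {..<m}"
  by (induction m arbitrary: \<phi>) auto

lemma existential_ex_block [simp]: "existential (ex_block m \<phi>) \<longleftrightarrow> existential \<phi>"
  by (induction m arbitrary: \<phi>) auto

lemma quantifier_depth_ex_block [simp]:
  "quantifier_depth (ex_block m \<phi>) = m + quantifier_depth \<phi>"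
  by (induction m arbitrary: \<phi>) auto

text \<open>The sign is computed from the given graph while the formula is built, so negations stay
  at atoms.\<close>

definition lit :: "bool \<Rightarrow> fo_formula \<Rightarrow> fo_formula" where
  "lit b \<phi> = (if b then \<phi> else Neg \<phi>)"

lemma lit_simps [simp]:
  "sat G e (lit b \<phi>) \<longleftrightarrow> (sat G e \<phi> \<longleftrightarrow> b)"
  "free_vars (lit b \<phi>) = free_vars \<phi>"
  "quantifier_depth (lit b \<phi>) = quantifier_depth \<phi>"
  "existential (lit b (Eq x y))"
  "existential (lit b (Adj x y))"
  by (auto simp: lit_def)

text \<open>The existential diagram of \<open>G\<close> embeds it into any model, and refuting the
  existence of one more vertex makes the embedding onto. This shows that \<open>D0\<close> is a
  minimum over a non-empty set, and it settles small orders.\<close>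

lemma definable0_card:
  assumes G: "simple_graph G"
  shows "definable0 (Suc (card (pverts G))) G"
proof -
  define n where "n = card (pverts G)"
  have fin: "finite (pverts G)" and ne: "pverts G \<noteq> {}" and arcs: "parcs G \<subseteq> pverts G \<times> pverts G"
    using G by (auto simp: simple_graph_iff)
  have "0 < n" using fin ne by (simp add: n_def card_gt_0_iff)
  obtain g where g: "bij_betw g {..<n} (pverts G)"
    unfolding n_def using fin ex_bij_betw_nat_finite[of "pverts G"] by (auto simp: atLeast0LessThan)
  define diag where "diag = ex_block n (conj_list (Eq 0 0)
    (concat (map (\<lambda>i. map (\<lambda>j. Conj (lit (i = j) (Eq i j)) (lit ((g i, g j) \<in> parcs G) (Adj i j)))
      [0..<n]) [0..<n])))"
  define many where "many = ex_block (Suc n) (conj_list (Eq 0 0)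
    (concat (map (\<lambda>i. map (\<lambda>j. lit (i = j) (Eq i j)) [0..<Suc n]) [0..<Suc n])))"
  have sat_diag: "sat H e diag \<longleftrightarrow> (\<exists>f. (\<forall>i<n. f i \<in> pverts H) \<and> inj_on f {..<n} \<and>
      (\<forall>i<n. \<forall>j<n. (f i, f j) \<in> parcs H \<longleftrightarrow> (g i, g j) \<in> parcs G))" for H e
    unfolding diag_def sat_ex_block by (intro arg_cong[of _ _ Ex] ext) (auto simp: inj_on_def)
  have sat_many: "sat H e many \<longleftrightarrow> (\<exists>f. (\<forall>i<Suc n. f i \<in> pverts H) \<and> inj_on f {..<Suc n})" for H e
    unfolding many_def sat_ex_block
    by (intro arg_cong[of _ _ Ex] ext) (auto simp: inj_on_def simp del: upt_Suc)
  show ?thesis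
  proof (rule definable0I[where P = "[diag]" and N = "[many]"])
    show "existential \<phi> \<and> free_vars \<phi> = {} \<and> quantifier_depth \<phi> \<le> Suc (card (pverts G))"
      if "\<phi> \<in> set [diag] \<union> set [many]" for \<phi>
    proof -
      have "quantifier_depth (conj_list \<psi> \<psi>s) = 0"
        if "quantifier_depth \<psi> = 0" "\<forall>\<chi>\<in>set \<psi>s. quantifier_depth \<chi> = 0" for \<psi> \<psi>s
        using quantifier_depth_conj_list_le[of \<psi> \<psi>s 0] that by auto
      then show ?thesis
        using that \<open>0 < n\<close> unfolding diag_def many_def
        by (auto simp: n_def[symmetric] simp del: upt_Suc)
    qed
    show "sat G e \<phi>" if "\<phi> \<in> set [diag]" for \<phi> e
      using that g by (auto simp: sat_diag bij_betw_def)
    have "\<not> sat G e many" for e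
    proof
      assume "sat G e many"
      then obtain f where "\<forall>i<Suc n. f i \<in> pverts G" "inj_on f {..<Suc n}" by (auto simp: sat_many)
      then have "card {..<Suc n} \<le> card (pverts G)" using fin by (intro card_inj_on_le[of f]) auto
      then show False by (simp add: n_def)
    qed
    then show "\<not> sat G e \<phi>" if "\<phi> \<in> set [many]" for \<phi> e using that by simp
  next
    fix H assume H: "simple_graph H" and "\<And>\<phi> e. \<phi> \<in> set [diag] \<Longrightarrow> sat H e \<phi>"
      and many: "\<And>\<phi> e. \<phi> \<in> set [many] \<Longrightarrow> \<not> sat H e \<phi>"
    then obtain f where f: "\<forall>i<n. f i \<in> pverts H" "inj_on f {..<n}"
      and adj: "\<forall>i<n. \<forall>j<n. (f i, f j) \<in> parcs H \<longleftrightarrow> (g i, g j) \<in> parcs G"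
      by (auto simp: sat_diag)
    have finH: "finite (pverts H)" using H by (simp add: simple_graph_iff)
    have "card (pverts H) \<le> n"
    proof (rule ccontr)
      assume "\<not> card (pverts H) \<le> n"
      then have "Suc n \<le> card (pverts H)" by simp
      moreover obtain k where "bij_betw k {0..<card (pverts H)} (pverts H)"
        using ex_bij_betw_nat_finite[OF finH] by blast
      ultimately have "(\<forall>i<Suc n. k i \<in> pverts H) \<and> inj_on k {..<Suc n}"
        by (auto simp: bij_betw_def inj_on_def)
      then have "sat H undefined many" unfolding sat_many by blast
      then show False using many by simp
    qed
    then have img: "f ` {..<n} = pverts H"
      using f finH by (intro card_seteq) (auto simp: card_image)
    then have bf: "bij_betw f {..<n} (pverts H)" using f by (simp add: bij_betw_def)
    show "digraph_iso (with_proj H) (with_proj G)"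
    proof (rule digraph_iso_with_proj[OF H _ arcs])
      show "bij_betw (g \<circ> the_inv_into {..<n} f) (pverts H) (pverts G)"
        using bij_betw_trans[OF bij_betw_the_inv_into[OF bf] g] .
    next
      fix u v assume "u \<in> pverts H" "v \<in> pverts H"
      then obtain i j where "u = f i" "v = f j" "i < n" "j < n" using img by blast
      then show "((g \<circ> the_inv_into {..<n} f) u, (g \<circ> the_inv_into {..<n} f) v) \<in> parcs G \<longleftrightarrow>
          (u, v) \<in> parcs H"
        using adj f(2) by (simp add: the_inv_into_f_f)
    qed
  qed (use ne in auto)
qed

text \<open>The free variable is \<open>t\<close> itself, so that nested identifying formulas use distinct variables.\<close>

definition identifiable :: "nat pair_pre_digraph \<Rightarrow> nat \<Rightarrow> nat \<Rightarrow> bool" where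
  "identifiable G t w \<longleftrightarrow> (\<exists>\<tau>. existential \<tau> \<and> free_vars \<tau> \<subseteq> {t} \<and> quantifier_depth \<tau> \<le> t \<and>
    (\<forall>e. e t \<in> pverts G \<longrightarrow> (sat G e \<tau> \<longleftrightarrow> e t = w)))"

lemma identifiable_witnesses:
  assumes "\<And>w. w \<in> S \<Longrightarrow> identifiable G t w"
  obtains \<tau> where "\<And>w. w \<in> S \<Longrightarrow> existential (\<tau> w)" "\<And>w x. w \<in> S \<Longrightarrow> x \<in> free_vars (\<tau> w) \<Longrightarrow> x = t"
    "\<And>w. w \<in> S \<Longrightarrow> quantifier_depth (\<tau> w) \<le> t"
    "\<And>w e. w \<in> S \<Longrightarrow> e t \<in> pverts G \<Longrightarrow> sat G e (\<tau> w) \<longleftrightarrow> e t = w"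
proof -
  have "\<forall>w\<in>S. \<exists>\<tau>. existential \<tau> \<and> (\<forall>x\<in>free_vars \<tau>. x = t) \<and> quantifier_depth \<tau> \<le> t \<and>
    (\<forall>e. e t \<in> pverts G \<longrightarrow> (sat G e \<tau> \<longleftrightarrow> e t = w))"
    using assms unfolding identifiable_def by blast
  from bchoice[OF this] obtain \<tau> where "\<forall>w\<in>S. existential (\<tau> w) \<and> (\<forall>x\<in>free_vars (\<tau> w). x = t) \<and>
    quantifier_depth (\<tau> w) \<le> t \<and> (\<forall>e. e t \<in> pverts G \<longrightarrow> (sat G e (\<tau> w) \<longleftrightarrow> e t = w))"
    by blast
  then show ?thesis by (intro that[of \<tau>]) blast+
qed

text \<open>Since the free variable is tied to the depth, raising the depth means handing the vertex
  over from variable \<open>t\<close> to \<open>Suc t\<close>.\<close>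

lemma identifiable_Suc:
  assumes "identifiable G t w" "w \<in> pverts G"
  shows "identifiable G (Suc t) w"
proof -
  obtain \<tau> where \<tau>: "existential \<tau>" "free_vars \<tau> \<subseteq> {t}" "quantifier_depth \<tau> \<le> t"
    "\<And>e. e t \<in> pverts G \<Longrightarrow> sat G e \<tau> \<longleftrightarrow> e t = w"
    using assms(1) by (auto simp: identifiable_def)
  show ?thesis unfolding identifiable_def
    by (rule exI[of _ "ExQ t (Conj \<tau> (Eq (Suc t) t))"]) (use \<tau> assms(2) in auto)
qed

lemma identifiable_by_neighbourhood:
  assumes S: "finite S" "S \<subseteq> pverts G" "\<And>w. w \<in> S \<Longrightarrow> identifiable G t w"
    and u: "u \<in> pverts G" "u \<notin> S"
    and uniq: "\<And>v. v \<in> pverts G \<Longrightarrow> v \<notin> S \<Longrightarrow>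
      (\<And>w. w \<in> S \<Longrightarrow> (v, w) \<in> parcs G \<longleftrightarrow> (u, w) \<in> parcs G) \<Longrightarrow> v = u"
  shows "identifiable G (Suc t) u"
proof -
  obtain \<tau> where \<tau>: "\<And>w. w \<in> S \<Longrightarrow> existential (\<tau> w)" "\<And>w x. w \<in> S \<Longrightarrow> x \<in> free_vars (\<tau> w) \<Longrightarrow> x = t"
    "\<And>w. w \<in> S \<Longrightarrow> quantifier_depth (\<tau> w) \<le> t"
    "\<And>w e. w \<in> S \<Longrightarrow> e t \<in> pverts G \<Longrightarrow> sat G e (\<tau> w) \<longleftrightarrow> e t = w"
    using identifiable_witnesses[of S G t] S(3) by blast
  obtain ws where ws: "set ws = S" using finite_list[OF S(1)] by blast
  \<comment> \<open>The inequality keeps the candidate outside \<open>S\<close>, where alone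
    \<open>u\<close> has to be unique. Quantifying the vertex \<open>w\<close> existentially makes
    non-adjacency to it an existential condition too.\<close>
  define \<phi> where "\<phi> = conj_list (Eq (Suc t) (Suc t)) (map (\<lambda>w. ExQ t (Conj (\<tau> w)
    (Conj (Neg (Eq (Suc t) t)) (lit ((u, w) \<in> parcs G) (Adj (Suc t) t))))) ws)"
  have "sat G e \<phi> \<longleftrightarrow> e (Suc t) = u" if "e (Suc t) \<in> pverts G" for e
  proof -
    have "sat G e \<phi> \<longleftrightarrow>
        (\<forall>w\<in>S. \<exists>v\<in>pverts G. v = w \<and> e (Suc t) \<noteq> v \<and> ((e (Suc t), v) \<in> parcs G \<longleftrightarrow> (u, w) \<in> parcs G))"
      using \<tau>(4) by (auto simp: \<phi>_def ws)
    also have "\<dots> \<longleftrightarrow> e (Suc t) = u" using S(2) u uniq[OF that] by blast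
    finally show ?thesis .
  qed
  then show ?thesis unfolding identifiable_def
    by (intro exI[of _ \<phi>]) (use \<tau> in \<open>auto simp: \<phi>_def ws\<close>)
qed

lemma definable0_identifiable:
  assumes G: "simple_graph G" and id: "\<And>w. w \<in> pverts G \<Longrightarrow> identifiable G t w"
  shows "definable0 (t + 3) G"
proof -
  define V where "V = pverts G"
  have fin: "finite V" and ne: "pverts G \<noteq> {}" and arcs: "parcs G \<subseteq> pverts G \<times> pverts G"
    using G by (auto simp: simple_graph_iff V_def)
  obtain \<tau> where \<tau>: "\<And>w. w \<in> V \<Longrightarrow> existential (\<tau> w)" "\<And>w x. w \<in> V \<Longrightarrow> x \<in> free_vars (\<tau> w) \<Longrightarrow> x = t"
    "\<And>w. w \<in> V \<Longrightarrow> quantifier_depth (\<tau> w) \<le> t"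
    "\<And>w e. w \<in> V \<Longrightarrow> e t \<in> pverts G \<Longrightarrow> sat G e (\<tau> w) \<longleftrightarrow> e t = w"
    using identifiable_witnesses[of V G t] id unfolding V_def by blast
  obtain ws where ws: "set ws = V" using finite_list[OF fin] by blast
  \<comment> \<open>\<open>\<sigma>\<close> is \<open>\<tau>\<close> moved to the variable
    \<open>Suc t\<close>. Its extra quantifier, with the two that open \<open>\<beta>\<close>, gives
    the depth \<open>t + 3\<close>.\<close>
  define \<sigma> where "\<sigma> w = ExQ t (Conj (\<tau> w) (Eq (Suc t) t))" for w
  define P where "P = map (\<lambda>w. ExQ t (\<tau> w)) ws"
  define \<beta> where "\<beta> w w' = ExQ (Suc t) (ExQ t (Conj (\<sigma> w) (Conj (\<tau> w')
    (Disj (lit (w \<noteq> w') (Eq (Suc t) t)) (lit ((w, w') \<notin> parcs G) (Adj (Suc t) t))))))" for w w'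
  \<comment> \<open>Being no realisation of \<open>\<tau> w\<close> would be a universal condition;
    differing from some realisation is an existential one. Refuting \<open>\<gamma>\<close> makes
    every vertex equal to all realisations of some \<open>\<tau> w\<close>, in particular to the
    chosen one.\<close>
  define \<gamma> where "\<gamma> = ExQ (Suc t) (conj_list (Eq (Suc t) (Suc t))
    (map (\<lambda>w. ExQ t (Conj (\<tau> w) (Neg (Eq (Suc t) t)))) ws))"
  define N where "N = \<gamma> # concat (map (\<lambda>w. map (\<beta> w) ws) ws)"
  have \<tau>_cong: "sat H e (\<tau> w) \<longleftrightarrow> sat H e' (\<tau> w)" if "w \<in> V" "e t = e' t" for H e e' w
    using \<tau>(2)[OF that(1)] that(2) by (intro sat_cong) auto
  \<comment> \<open>\<open>R H w v\<close> says that \<open>v\<close> realises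
    \<open>\<tau> w\<close> in \<open>H\<close>. The default 0 need not be a vertex: only the value
    at \<open>t\<close> matters.\<close>
  define R where "R H w v \<longleftrightarrow> sat H ((\<lambda>_. 0)(t := v)) (\<tau> w)" for H w v
  have sat_\<tau>: "sat H e (\<tau> w) \<longleftrightarrow> R H w (e t)" if "w \<in> V" for H e w
    unfolding R_def by (rule \<tau>_cong) (use that in auto)
  have R_G: "R G w v \<longleftrightarrow> v = w" if "w \<in> V" "v \<in> pverts G" for w v
    using \<tau>(4)[OF that(1), of "(\<lambda>_. 0)(t := v)"] that(2) by (simp add: R_def)
  have sat_P: "(\<forall>\<phi>\<in>set P. sat H e \<phi>) \<longleftrightarrow> (\<forall>w\<in>V. \<exists>v\<in>pverts H. R H w v)" for H e
    by (auto simp: P_def ws sat_\<tau>)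
  have sat_\<beta>: "sat H e (\<beta> w w') \<longleftrightarrow> (\<exists>v\<in>pverts H. \<exists>v'\<in>pverts H. R H w v \<and> R H w' v' \<and>
      ((v = v') \<noteq> (w = w') \<or> ((v, v') \<in> parcs H) \<noteq> ((w, w') \<in> parcs G)))"
    if "w \<in> V" "w' \<in> V" for H e w w'
    using that by (auto simp: \<beta>_def \<sigma>_def sat_\<tau>)
  have sat_\<gamma>: "sat H e \<gamma> \<longleftrightarrow> (\<exists>v\<in>pverts H. \<forall>w\<in>V. \<exists>v'\<in>pverts H. R H w v' \<and> v \<noteq> v')" for H e
    by (auto simp: \<gamma>_def ws sat_\<tau>)
  have sat_N: "(\<forall>\<phi>\<in>set N. \<not> sat H e \<phi>) \<longleftrightarrow>
      \<not> sat H e \<gamma> \<and> (\<forall>w\<in>V. \<forall>w'\<in>V. \<not> sat H e (\<beta> w w'))" for H e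
    by (auto simp: N_def ws)
  show ?thesis
  proof (rule definable0I[where P = P and N = N])
    show "existential \<phi> \<and> free_vars \<phi> = {} \<and> quantifier_depth \<phi> \<le> t + 3"
      if \<phi>: "\<phi> \<in> set P \<union> set N" for \<phi>
    proof -
      have \<beta>: "existential (\<beta> w w') \<and> free_vars (\<beta> w w') = {} \<and>
          quantifier_depth (\<beta> w w') \<le> t + 3" if "w \<in> V" "w' \<in> V" for w w'
        using \<tau>(1)[OF that(1)] \<tau>(1)[OF that(2)] \<tau>(3)[OF that(1)] \<tau>(3)[OF that(2)]
          \<tau>(2)[OF that(1)] \<tau>(2)[OF that(2)] by (auto simp: \<beta>_def \<sigma>_def)
      have \<gamma>: "existential \<gamma> \<and> free_vars \<gamma> = {} \<and> quantifier_depth \<gamma> \<le> t + 3"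
      proof -
        have "quantifier_depth (conj_list (Eq (Suc t) (Suc t))
            (map (\<lambda>w. ExQ t (Conj (\<tau> w) (Neg (Eq (Suc t) t)))) ws)) \<le> t + 2"
          using \<tau>(3) by (auto simp: ws le_SucI)
        then show ?thesis using \<tau>(1,2) by (auto simp: \<gamma>_def ws)
      qed
      have "existential (ExQ t (\<tau> w)) \<and> free_vars (ExQ t (\<tau> w)) = {} \<and>
          quantifier_depth (ExQ t (\<tau> w)) \<le> t + 3" if "w \<in> V" for w
        using \<tau>(1)[OF that] \<tau>(2)[OF that] \<tau>(3)[OF that] by auto
      moreover have "(\<exists>w\<in>V. \<phi> = ExQ t (\<tau> w)) \<or> \<phi> = \<gamma> \<or> (\<exists>w\<in>V. \<exists>w'\<in>V. \<phi> = \<beta> w w')"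
        using \<phi> by (auto simp: P_def N_def ws)
      ultimately show ?thesis using \<beta> \<gamma> by metis
    qed
    have "\<forall>\<phi>\<in>set P. sat G e \<phi>" for e unfolding sat_P using R_G by (auto simp: V_def)
    then show "sat G e \<phi>" if "\<phi> \<in> set P" for \<phi> e using that by blast
    have "\<forall>\<phi>\<in>set N. \<not> sat G e \<phi>" for e
      unfolding sat_N sat_\<gamma> by (auto simp: sat_\<beta> R_G) (auto simp: V_def R_G)
    then show "\<not> sat G e \<phi>" if "\<phi> \<in> set N" for \<phi> e using that by blast
  next
    fix H assume H: "simple_graph H" and P: "\<And>\<phi> e. \<phi> \<in> set P \<Longrightarrow> sat H e \<phi>"
      and N: "\<And>\<phi> e. \<phi> \<in> set N \<Longrightarrow> \<not> sat H e \<phi>"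
    have "\<forall>w\<in>V. \<exists>v\<in>pverts H. R H w v" using P sat_P by blast
    then obtain h where h: "\<And>w. w \<in> V \<Longrightarrow> h w \<in> pverts H \<and> R H w (h w)" by metis
    have N': "\<not> sat H e \<gamma> \<and> (\<forall>w\<in>V. \<forall>w'\<in>V. \<not> sat H e (\<beta> w w'))" for e
      using N sat_N[of H e] by blast
    have surj: "\<exists>w\<in>V. v = h w" if "v \<in> pverts H" for v
      using N' that h unfolding sat_\<gamma> by blast
    have B: "(h w = h w' \<longleftrightarrow> w = w') \<and> ((h w, h w') \<in> parcs H \<longleftrightarrow> (w, w') \<in> parcs G)"
      if "w \<in> V" "w' \<in> V" for w w'
      using N' that h sat_\<beta>[OF that] by blast
    have bij: "bij_betw h V (pverts H)"
      unfolding bij_betw_def inj_on_def using B h surj by blast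
    show "digraph_iso (with_proj H) (with_proj G)"
    proof (rule digraph_iso_with_proj[OF H _ arcs])
      show "bij_betw (the_inv_into V h) (pverts H) (pverts G)"
        using bij_betw_the_inv_into[OF bij] by (simp add: V_def)
    next
      fix u v assume "u \<in> pverts H" "v \<in> pverts H"
      then obtain w w' where "u = h w" "v = h w'" "w \<in> V" "w' \<in> V" using surj by blast
      then show "(the_inv_into V h u, the_inv_into V h v) \<in> parcs G \<longleftrightarrow> (u, v) \<in> parcs H"
        using B bij by (simp add: the_inv_into_f_f bij_betw_def)
    qed
  qed (use ne in auto)
qed

section \<open>The layered graph\<close>

primrec layer_size :: "nat \<Rightarrow> nat" where
  "layer_size 0 = 2"
| "layer_size (Suc j) = 2 ^ layer_size j - 1"

text \<open>Layer 0 consists of 5 and 6, the last two vertices of the gadget on 0 to 6; layer 1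
  starts at 7.\<close>

primrec layer_start :: "nat \<Rightarrow> nat" where
  "layer_start 0 = 5"
| "layer_start (Suc j) = layer_start j + layer_size j"

definition in_layer :: "nat \<Rightarrow> nat \<Rightarrow> bool" where
  "in_layer j x \<longleftrightarrow> layer_start j \<le> x \<and> x < layer_start (Suc j)"

text \<open>A pentagon 1, 2, 4, 6, 3 with a triangle erected on the edge between 1 and 2, and a
  pendant vertex 5 at 4 that breaks the reflection. Only 5 and 6 receive neighbours beyond the
  gadget.\<close>

definition gadget :: "(nat \<times> nat) list" where
  "gadget = [(0, 1), (0, 2), (1, 2), (1, 3), (2, 4), (4, 5), (4, 6), (3, 6)]"

text \<open>
  The vertex with offset \<open>m\<close> in layer \<open>j + 1\<close> is joined to the set of vertices of layer \<open>j\<close> with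
  binary code \<open>m + 1\<close>. The empty set is left out, as all vertices of later layers would share it.
\<close>

definition layer_arc :: "nat \<Rightarrow> nat \<Rightarrow> bool" where
  "layer_arc x y \<longleftrightarrow> (\<exists>j. in_layer j x \<and> in_layer (Suc j) y \<and>
    x - layer_start j \<in> set_decode (Suc (y - layer_start (Suc j))))"

definition layered_adj :: "nat \<Rightarrow> nat \<Rightarrow> bool" where
  "layered_adj x y \<longleftrightarrow> (x, y) \<in> set gadget \<or> (y, x) \<in> set gadget \<or> layer_arc x y \<or> layer_arc y x"

text \<open>One infinite graph, cut off after \<open>n\<close> vertices, serves all orders. Every
  vertex beyond the gadget is identified through earlier layers, so the cut does no harm once the
  gadget is inside.\<close>

definition layered_graph :: "nat \<Rightarrow> nat pair_pre_digraph" where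
  "layered_graph n = \<lparr>pverts = {..<n}, parcs = {(x, y). x < n \<and> y < n \<and> layered_adj x y}\<rparr>"

lemma layered_graph_simps [simp]:
  "pverts (layered_graph n) = {..<n}"
  "(x, y) \<in> parcs (layered_graph n) \<longleftrightarrow> x < n \<and> y < n \<and> layered_adj x y"
  by (auto simp: layered_graph_def)

lemma layer_start_mono: "i \<le> j \<Longrightarrow> layer_start i \<le> layer_start j"
  by (rule lift_Suc_mono_le) auto

lemma in_layer_unique: "in_layer i x \<Longrightarrow> in_layer j x \<Longrightarrow> i = j"
  using layer_start_mono[of "Suc i" j] layer_start_mono[of "Suc j" i]
  unfolding in_layer_def by (meson leD le_less_trans less_le_trans not_less_eq_eq le_Suc_eq not_less linorder_neqE_nat Suc_leI)

lemma layer_arc_less: "layer_arc x y \<Longrightarrow> 5 \<le> x \<and> 7 \<le> y \<and> x < y"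
proof -
  assume "layer_arc x y"
  then obtain j where "in_layer j x" "in_layer (Suc j) y" by (auto simp: layer_arc_def)
  then show ?thesis
    using layer_start_mono[of 0 j] layer_start_mono[of 1 "Suc j"] by (auto simp: in_layer_def)
qed

lemma layered_adj_sym: "layered_adj x y \<longleftrightarrow> layered_adj y x"
  by (auto simp: layered_adj_def)

lemma layered_adj_irrefl: "\<not> layered_adj x x"
  using layer_arc_less[of x x] by (auto simp: layered_adj_def gadget_def)

lemma layered_adj_small:
  "layered_adj 0 y \<longleftrightarrow> y = 1 \<or> y = 2"
  "layered_adj 1 y \<longleftrightarrow> y = 0 \<or> y = 2 \<or> y = 3"
  "layered_adj (Suc 0) y \<longleftrightarrow> y = 0 \<or> y = 2 \<or> y = 3"
  "layered_adj 2 y \<longleftrightarrow> y = 0 \<or> y = 1 \<or> y = 4"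
  "layered_adj 3 y \<longleftrightarrow> y = 1 \<or> y = 6"
  "layered_adj 4 y \<longleftrightarrow> y = 2 \<or> y = 5 \<or> y = 6"
  by (auto simp: layered_adj_def gadget_def dest: layer_arc_less)

text \<open>No gadget edge has both ends from 5 on, and layer arcs join consecutive layers. So this
  part of the graph is bipartite by the parity of the layer.\<close>

lemma layered_adj_parity:
  assumes "layered_adj x y" "5 \<le> x" "5 \<le> y"
  shows "(\<exists>j. in_layer j x \<and> even j) \<longleftrightarrow> \<not> (\<exists>j. in_layer j y \<and> even j)"
proof -
  have "(\<exists>j. in_layer j u \<and> even j) \<longleftrightarrow> \<not> (\<exists>j. in_layer j v \<and> even j)" if "layer_arc u v" for u v
    using that in_layer_unique unfolding layer_arc_def by (metis even_Suc)
  moreover have "layer_arc x y \<or> layer_arc y x"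
    using assms by (auto simp: layered_adj_def gadget_def)
  ultimately show ?thesis by blast
qed

text \<open>The neighbours of 3 are pairwise non-adjacent, as are those of 4, and 0, 1, 2 have no
  neighbour from 5 on. Any other triangle would lie in the bipartite part.\<close>

lemma layered_triangle:
  assumes "layered_adj x y" "layered_adj y z" "layered_adj x z"
  shows "x \<in> {0, 1, 2}"
proof (rule ccontr)
  assume x: "x \<notin> {0, 1, 2}"
  have "in_layer 0 5" "in_layer 0 6" by (simp_all add: in_layer_def)
  then have parity: "\<exists>j. in_layer j 5 \<and> even j" "\<exists>j. in_layer j 6 \<and> even j" by auto
  have no56: "\<not> layered_adj 5 6" "\<not> layered_adj 6 5"
    using layered_adj_parity[of 5 6] layered_adj_parity[of 6 5] parity by auto
  have far: "\<not> layered_adj 6 1" "\<not> layered_adj 5 2" "\<not> layered_adj 6 2"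
    unfolding layered_adj_sym[of 6] layered_adj_sym[of 5] layered_adj_small by simp_all
  have no34: "u \<noteq> 3 \<and> u \<noteq> 4" if "layered_adj u v" "layered_adj v w" "layered_adj u w" for u v w
    using that no56 far layered_adj_irrefl by (auto simp: layered_adj_small)
  have "x \<noteq> 3 \<and> x \<noteq> 4" "y \<noteq> 3 \<and> y \<noteq> 4" "z \<noteq> 3 \<and> z \<noteq> 4"
    using no34 assms layered_adj_sym by blast+
  then have "5 \<le> x" using x by auto
  moreover have "5 \<le> y \<and> 5 \<le> z"
  proof (rule ccontr)
    assume "\<not> (5 \<le> y \<and> 5 \<le> z)"
    then have "y \<in> {0, 1, 2} \<or> z \<in> {0, 1, 2}"
      using \<open>y \<noteq> 3 \<and> y \<noteq> 4\<close> \<open>z \<noteq> 3 \<and> z \<noteq> 4\<close> by auto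
    then show False
      using \<open>5 \<le> x\<close> assms by (auto simp: layered_adj_sym[of x] layered_adj_small)
  qed
  ultimately show False
    using layered_adj_parity[OF assms(1)] layered_adj_parity[OF assms(2)] layered_adj_parity[OF assms(3)]
    by blast
qed

text \<open>
  The only triangle goes to itself. Of its vertices only 1 and 2 have further neighbours, namely
  3 and 4, and 3 has too few neighbours to play the role of 4.
\<close>

lemma gadget_rigid:
  assumes inj: "\<And>i j. i < 7 \<Longrightarrow> j < 7 \<Longrightarrow> i \<noteq> j \<Longrightarrow> f i \<noteq> f j"
    and adj: "\<And>i j. (i, j) \<in> set gadget \<Longrightarrow> layered_adj (f i) (f j)"
    and "i < 7"
  shows "f i = i"
proof -
  have e: "layered_adj (f 0) (f 1)" "layered_adj (f 0) (f 2)" "layered_adj (f 1) (f 2)"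
    "layered_adj (f 1) (f 3)" "layered_adj (f 2) (f 4)" "layered_adj (f 4) (f 5)"
    "layered_adj (f 4) (f 6)" "layered_adj (f 3) (f 6)"
    using adj by (auto simp: gadget_def)
  have d: "f 0 \<noteq> f 1" "f 0 \<noteq> f 2" "f 1 \<noteq> f 2" "f 3 \<noteq> f 0" "f 3 \<noteq> f 2" "f 4 \<noteq> f 0" "f 4 \<noteq> f 1"
    "f 5 \<noteq> f 2" "f 6 \<noteq> f 2" "f 5 \<noteq> f 6" "f 6 \<noteq> f 1"
    using inj by auto
  have t: "f 0 \<in> {0, 1, 2}" "f 1 \<in> {0, 1, 2}" "f 2 \<in> {0, 1, 2}"
    using layered_triangle e(1-3) layered_adj_sym by blast+
  have "f 1 \<noteq> 0"
  proof
    assume "f 1 = 0"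
    then have "f 3 = 1 \<or> f 3 = 2" using e(4) by (simp add: layered_adj_small)
    then show False using t d(1-5) \<open>f 1 = 0\<close> by auto
  qed
  moreover have "f 2 \<noteq> 0"
  proof
    assume "f 2 = 0"
    then have "f 4 = 1 \<or> f 4 = 2" using e(5) by (simp add: layered_adj_small)
    then show False using t d(1-3,6,7) \<open>f 2 = 0\<close> by auto
  qed
  ultimately have f0: "f 0 = 0" using t d by auto
  have f2: "f 2 = 2"
  proof (rule ccontr)
    assume "f 2 \<noteq> 2"
    then have "f 2 = 1" "f 1 = 2" using t d f0 by auto
    moreover from this have "f 4 = 3" using e(5) d f0 by (auto simp: layered_adj_small)
    ultimately show False using e(6,7) d by (auto simp: layered_adj_small)
  qed
  then have f1: "f 1 = 1" using t d f0 by auto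
  have f3: "f 3 = 3" using e(4) d f0 f1 f2 by (auto simp: layered_adj_small)
  have f4: "f 4 = 4" using e(5) d f0 f1 f2 by (auto simp: layered_adj_small)
  have f6: "f 6 = 6" using e(8) d f1 f3 by (auto simp: layered_adj_small)
  have f5: "f 5 = 5" using e(6) d f2 f4 f6 by (auto simp: layered_adj_small)
  have "i = 0 \<or> i = 1 \<or> i = 2 \<or> i = 3 \<or> i = 4 \<or> i = 5 \<or> i = 6" using \<open>i < 7\<close> by auto
  then show ?thesis using f0 f1 f2 f3 f4 f5 f6 by auto
qed

lemma simple_graph_layered: "0 < n \<Longrightarrow> simple_graph (layered_graph n)"
  using layered_adj_irrefl layered_adj_sym
  by (auto simp: simple_graph_iff irrefl_def sym_def)

lemma identifiable_gadget:
  assumes "7 \<le> n" "w < 7"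
  shows "identifiable (layered_graph n) 7 w"
proof -
  \<comment> \<open>Variables 0 to 6 hold a copy of the gadget and the free variable 7 equals the
    one numbered \<open>w\<close>. Non-edges are not mentioned: \<open>gadget_rigid\<close> applies
    to every injective map that preserves the edges.\<close>
  define \<tau> where "\<tau> = ex_block 7 (conj_list (Eq 7 w)
    (concat (map (\<lambda>i. map (\<lambda>j. lit (i = j) (Eq i j)) [0..<7]) [0..<7]) @
     map (\<lambda>(i, j). Adj i j) gadget))"
  have g7: "i < 7 \<and> j < 7" if "(i, j) \<in> set gadget" for i j
    using that by (auto simp: gadget_def)
  have gn: "i < n \<and> j < n" if "(i, j) \<in> set gadget" for i j
    using g7[OF that] assms(1) by simp
  have "sat (layered_graph n) e \<tau> \<longleftrightarrow> e 7 = w" if "e 7 < n" for e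
  proof
    assume "sat (layered_graph n) e \<tau>"
    then obtain f where f: "e 7 = f w" "\<forall>i<7. \<forall>j<7. f i = f j \<longleftrightarrow> i = j"
      "\<forall>(i, j)\<in>set gadget. layered_adj (f i) (f j)"
      using assms(2) g7 unfolding \<tau>_def sat_ex_block by (fastforce simp: ball_Un)
    have "f w = w" by (rule gadget_rigid) (use f assms(2) in auto)
    then show "e 7 = w" using f by simp
  next
    assume "e 7 = w"
    then show "sat (layered_graph n) e \<tau>"
      unfolding \<tau>_def sat_ex_block using assms g7
      by (intro exI[of _ "\<lambda>i. i"]) (auto simp: ball_Un layered_adj_def dest: g7 gn)
  qed
  moreover have "quantifier_depth (conj_list (Eq 7 w)
    (concat (map (\<lambda>i. map (\<lambda>j. lit (i = j) (Eq i j)) [0..<7]) [0..<7]) @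
     map (\<lambda>(i, j). Adj i j) gadget)) \<le> 0"
    unfolding quantifier_depth_conj_list_le by auto
  ultimately show ?thesis unfolding identifiable_def
    using assms(2) by (intro exI[of _ \<tau>]) (auto simp: \<tau>_def dest: g7)
qed

lemma set_decode_less:
  assumes "m < 2 ^ s" "i \<in> set_decode m"
  shows "i < s"
proof (rule ccontr)
  assume "\<not> i < s"
  then have "(2::nat) ^ s \<le> 2 ^ i" by (intro power_increasing) auto
  then have "m < 2 ^ i" using assms(1) by linarith
  then show False using assms(2) by (simp add: set_decode_def)
qed

lemma set_decode_inj: "set_decode m = set_decode k \<Longrightarrow> m = k"
  by (metis set_decode_inverse)

lemma identifiable_layers:
  assumes "7 \<le> n" "w < n" "w < layer_start (Suc j)"
  shows "identifiable (layered_graph n) (7 + j) w"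
  using assms(2,3)
proof (induction j arbitrary: w)
  case 0
  then show ?case using identifiable_gadget[OF assms(1)] by simp
next
  case (Suc j)
  define G where "G = layered_graph n"
  define S where "S = {x. x < n \<and> x < layer_start (Suc j)}"
  have S: "identifiable G (7 + j) x" if "x \<in> S" for x
    using Suc.IH that by (simp add: S_def G_def)
  show ?case
  proof (cases "w \<in> S")
    case True
    then show ?thesis using identifiable_Suc[OF S[OF True]] Suc.prems by (simp add: G_def)
  next
    case False
    then have w: "in_layer (Suc j) w" using Suc.prems by (simp add: S_def in_layer_def)
    \<comment> \<open>Seen from \<open>S\<close>, a vertex outside has neighbours only if it lies in
      layer \<open>j + 1\<close>; these are then the vertices of layer \<open>j\<close> named by its
      code.\<close>
    have adj: "layered_adj v x \<longleftrightarrow>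
        in_layer (Suc j) v \<and> in_layer j x \<and> x - layer_start j \<in> set_decode (Suc (v - layer_start (Suc j)))"
      if "x \<in> S" "v \<notin> S" "v < n" for x v
    proof -
      have v: "layer_start (Suc j) \<le> v" "x < layer_start (Suc j)" using that by (auto simp: S_def)
      then have "7 \<le> v" using layer_start_mono[of 1 "Suc j"] by auto
      then have "(x, v) \<notin> set gadget" "(v, x) \<notin> set gadget" by (auto simp: gadget_def)
      moreover have "\<not> layer_arc v x" using v layer_arc_less by fastforce
      ultimately have "layered_adj v x \<longleftrightarrow> layer_arc x v" by (auto simp: layered_adj_def)
      also have "\<dots> \<longleftrightarrow> in_layer (Suc j) v \<and> in_layer j x \<and> x - layer_start j \<in> set_decode (Suc (v - layer_start (Suc j)))"
      proof
        assume "layer_arc x v"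
        then obtain i where i: "in_layer i x" "in_layer (Suc i) v"
          "x - layer_start i \<in> set_decode (Suc (v - layer_start (Suc i)))"
          by (auto simp: layer_arc_def)
        have "i \<le> j"
          using v(2) i(1) layer_start_mono[of "Suc j" i] by (force simp: in_layer_def not_less_eq_eq)
        moreover have "j \<le> i"
          using v(1) i(2) layer_start_mono[of "Suc (Suc i)" "Suc j"] by (force simp: in_layer_def not_less_eq_eq)
        ultimately show "in_layer (Suc j) v \<and> in_layer j x \<and> x - layer_start j \<in> set_decode (Suc (v - layer_start (Suc j)))"
          using i by auto
      qed (auto simp: layer_arc_def)
      finally show ?thesis .
    qed
    have code_less: "i < layer_size j" if "in_layer (Suc j) v" "i \<in> set_decode (Suc (v - layer_start (Suc j)))" for i v
      using that by (intro set_decode_less[OF _ that(2)]) (auto simp: in_layer_def)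
    have bit: "layer_start j + i \<in> S" "in_layer j (layer_start j + i)" if "i < layer_size j" for i
      using that Suc.prems w by (auto simp: S_def in_layer_def)
    have adj': "layered_adj v (layer_start j + i) \<longleftrightarrow> in_layer (Suc j) v \<and> i \<in> set_decode (Suc (v - layer_start (Suc j)))"
      if "i < layer_size j" "v \<notin> S" "v < n" for i v
      using adj[OF bit(1)[OF that(1)] that(2,3)] bit(2)[OF that(1)] by simp
    have "identifiable G (Suc (7 + j)) w"
    proof (rule identifiable_by_neighbourhood[of S])
      fix v assume v: "v \<in> pverts G" "v \<notin> S"
        and eq: "\<And>x. x \<in> S \<Longrightarrow> (v, x) \<in> parcs G \<longleftrightarrow> (w, x) \<in> parcs G"
      have vn: "v < n" using v by (simp add: G_def)
      have eq': "layered_adj v (layer_start j + i) \<longleftrightarrow> layered_adj w (layer_start j + i)"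
        if "i < layer_size j" for i
        using eq[OF bit(1)[OF that]] bit(1)[OF that] vn Suc.prems(1) by (simp add: G_def S_def)
      define code where "code v = set_decode (Suc (v - layer_start (Suc j)))" for v
      have mem: "i \<in> code v \<and> in_layer (Suc j) v \<longleftrightarrow> i \<in> code w" if "i < layer_size j" for i
        using adj'[OF that v(2) vn] adj'[OF that False Suc.prems(1)] eq'[OF that] w
        by (auto simp: code_def)
      have bound: "i < layer_size j" if "in_layer (Suc j) v" "i \<in> code v" for i v
        using code_less that by (simp add: code_def)
      \<comment> \<open>The code of \<open>w\<close> is positive, so \<open>w\<close> has a
        neighbour in layer \<open>j\<close>. Then so has \<open>v\<close>, which places
        \<open>v\<close> in layer \<open>j + 1\<close> and not later.\<close>
      have "set_decode (Suc (w - layer_start (Suc j))) \<noteq> {}"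
        using set_decode_inj[of _ 0] by auto
      then obtain i where "i \<in> code w" by (auto simp: code_def)
      then have lv: "in_layer (Suc j) v" using mem bound[OF w] by blast
      \<comment> \<open>Agreement on the bits below \<open>layer_size j\<close> suffices, as codes
        in layer \<open>j + 1\<close> have no higher bits.\<close>
      have "code v = code w" using mem bound[OF w] bound[OF lv] lv by blast
      then have "Suc (v - layer_start (Suc j)) = Suc (w - layer_start (Suc j))"
        unfolding code_def by (rule set_decode_inj)
      then show "v = w" using w lv unfolding in_layer_def by linarith
    qed (use S Suc.prems False in \<open>auto simp: S_def G_def\<close>)
    then show ?thesis by (simp add: G_def)
  qed
qed

section \<open>The upper bound\<close>

primrec tower :: "nat \<Rightarrow> nat" where
  "tower 0 = 1"
| "tower (Suc k) = 2 ^ tower k"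

lemma less_tower: "k < tower k"
proof (induction k)
  case (Suc k)
  then have "Suc k \<le> tower k" by simp
  also have "tower k < 2 ^ tower k" by (rule less_exp)
  finally show ?case by simp
qed simp

lemma tower_mono: "i \<le> j \<Longrightarrow> tower i \<le> tower j"
  by (rule lift_Suc_mono_le) (auto intro: less_imp_le less_exp)

text \<open>The conclusion is about some \<open>j \<le> k\<close> and not \<open>k\<close> itself:
  once an iterate is at most 1, further logarithms soon leave the positive reals.\<close>

lemma log_iterates_of_le_tower:
  assumes "x \<le> real (tower k)"
  shows "\<exists>j\<le>k. (log 2 ^^ j) x \<le> 1"
  using assms
proof (induction k arbitrary: x)
  case (Suc k)
  show ?case
  proof (cases "x \<le> 1")
    case False
    then have "log 2 x \<le> real (tower k)"
      using Suc.prems by (subst log_le_iff) (auto simp: powr_realpow)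
    then obtain j where "j \<le> k" "(log 2 ^^ j) (log 2 x) \<le> 1" using Suc.IH by blast
    then show ?thesis by (intro exI[of _ "Suc j"]) (simp add: funpow_Suc_right del: funpow.simps)
  qed (auto intro: exI[of _ 0])
qed auto

lemma log_star_exists: "\<exists>k. (log 2 ^^ k) x \<le> 1"
proof -
  obtain k :: nat where "x \<le> real k" using real_arch_simple by blast
  then have "x \<le> real (tower k)" using less_tower[of k] by linarith
  then show ?thesis using log_iterates_of_le_tower by blast
qed

text \<open>As the earlier iterates exceed 1, each logarithm can be undone by
  exponentiation.\<close>

lemma le_tower_of_log_iterate:
  assumes "(log 2 ^^ k) x \<le> 1" "\<And>j. j < k \<Longrightarrow> (log 2 ^^ j) x > 1"
  shows "x \<le> real (tower k)"
  using assms
proof (induction k arbitrary: x)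
  case (Suc k)
  have "x > 1" using Suc.prems(2)[of 0] by simp
  have "log 2 x \<le> real (tower k)"
  proof (rule Suc.IH)
    show "(log 2 ^^ k) (log 2 x) \<le> 1"
      using Suc.prems(1) by (simp add: funpow_Suc_right del: funpow.simps)
    show "(log 2 ^^ j) (log 2 x) > 1" if "j < k" for j
      using Suc.prems(2)[of "Suc j"] that by (simp add: funpow_Suc_right del: funpow.simps)
  qed
  then have "x \<le> 2 powr real (tower k)" using \<open>x > 1\<close> by (subst (asm) log_le_iff) auto
  then show ?case by (simp add: powr_realpow)
qed simp

text \<open>A Galois connection between \<open>log_star\<close> and \<open>tower\<close>, through
  which both bounds access \<open>log_star\<close>.\<close>

lemma log_star_le_iff: "log_star x \<le> k \<longleftrightarrow> x \<le> real (tower k)"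
proof
  assume "log_star x \<le> k"
  have "x \<le> real (tower (log_star x))"
  proof (rule le_tower_of_log_iterate)
    show "(log 2 ^^ log_star x) x \<le> 1"
      unfolding log_star_def using log_star_exists by (rule LeastI_ex)
    show "(log 2 ^^ j) x > 1" if "j < log_star x" for j
      using not_less_Least[of j "\<lambda>k. (log 2 ^^ k) x \<le> 1"] that by (simp add: log_star_def not_le)
  qed
  also have "\<dots> \<le> real (tower k)" using tower_mono[OF \<open>log_star x \<le> k\<close>] by simp
  finally show "x \<le> real (tower k)" .
next
  assume "x \<le> real (tower k)"
  then obtain j where "j \<le> k" "(log 2 ^^ j) x \<le> 1" using log_iterates_of_le_tower by blast
  then show "log_star x \<le> k" unfolding log_star_def using Least_le le_trans by metis
qed

text \<open>The strict inequality gains a factor 2 at the next level, which absorbs the 1 subtracted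
  in \<open>layer_size\<close>.\<close>

lemma tower_less_layer_size: "tower k < layer_size (Suc k)"
proof (induction k)
  case (Suc k)
  have "2 * tower (Suc k) = 2 ^ Suc (tower k)" by simp
  also have "\<dots> \<le> 2 ^ layer_size (Suc k)" using Suc by (intro power_increasing) auto
  finally have "2 * tower (Suc k) \<le> 2 ^ layer_size (Suc k)" .
  moreover have "2 \<le> tower (Suc k)" using tower_mono[of 1 "Suc k"] by simp
  ultimately show ?case unfolding layer_size.simps(2)[of "Suc k"] by linarith
qed simp

lemma q0_le_D0:
  assumes "simple_graph G"
  shows "q0 (card (pverts G)) \<le> D0 G"
  unfolding q0_def using assms by (intro Least_le) blast

lemma q0_upper:
  assumes "1 \<le> n"
  shows "q0 n \<le> log_star (real n) + 22"
proof (cases "7 \<le> n")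
  case True
  define k where "k = log_star (real n)"
  have "n \<le> tower k" using log_star_le_iff[of "real n" k] by (simp add: k_def)
  also have "\<dots> \<le> layer_start (Suc (Suc k))" using tower_less_layer_size[of k] by simp
  finally have n: "n \<le> layer_start (Suc (Suc k))" .
  \<comment> \<open>Seven quantifiers for the gadget, one for each of the layers 1 to
    \<open>k + 1\<close>, and three for the final sentence.\<close>
  have "definable0 (7 + Suc k + 3) (layered_graph n)"
  proof (rule definable0_identifiable)
    show "simple_graph (layered_graph n)" using True by (intro simple_graph_layered) simp
    show "identifiable (layered_graph n) (7 + Suc k) w" if "w \<in> pverts (layered_graph n)" for w
      by (rule identifiable_layers[OF True]) (use that n in \<open>auto simp del: layer_start.simps\<close>)
  qed
  then have "D0 (layered_graph n) \<le> 7 + Suc k + 3" by (rule D0_le)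
  then show ?thesis
    using q0_le_D0[OF simple_graph_layered, of n] True by (simp add: k_def)
next
  case False
  have G: "simple_graph (layered_graph n)" using assms by (intro simple_graph_layered) simp
  \<comment> \<open>There are at most 6 vertices, so depth 7 is enough.\<close>
  from D0_le[OF definable0_card[OF G]] q0_le_D0[OF G] False show ?thesis by simp
qed

section \<open>The lower bound\<close>

lemma set_encode_less:
  assumes "\<And>c. c \<in> A \<Longrightarrow> c < m"
  shows "set_encode A < 2 ^ m"
proof -
  have fin: "finite A" using assms by (intro finite_subset[of A "{..<m}"]) auto
  have "set_encode A \<le> set_encode {..<m}"
    by (rule subset_decode_imp_le) (use fin assms in auto)
  also have "\<dots> < 2 ^ m"
    by (simp add: set_encode_def lessThan_atLeast0 sum_power2)
  finally show ?thesis .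
qed

lemma triangle_mono: "i \<le> j \<Longrightarrow> triangle i \<le> triangle j"
  by (rule lift_Suc_mono_le) auto

text \<open>Positions \<open>a < b\<close> are coded as \<open>prod_encode (a, b - a - 1)\<close>.
  Since \<open>prod_encode\<close> runs along diagonals of constant sum, here \<open>b - 1\<close>,
  the pairs fill exactly the numbers below \<open>triangle (length xs - 1)\<close>.\<close>

definition atomic_code :: "nat pair_pre_digraph \<Rightarrow> nat list \<Rightarrow> nat" where
  "atomic_code G xs = set_encode {prod_encode (i, j) | i j. Suc (i + j) < length xs \<and>
    (xs ! i, xs ! Suc (i + j)) \<in> parcs G}"

text \<open>
  For \<open>Suc k\<close> the adjacencies within \<open>xs\<close> are recorded only if some vertex lies outside \<open>xs\<close>; this
  is why the results below ask for enough vertices.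
\<close>

primrec tuple_type :: "nat pair_pre_digraph \<Rightarrow> nat \<Rightarrow> nat list \<Rightarrow> nat" where
  "tuple_type G 0 xs = atomic_code G xs"
| "tuple_type G (Suc k) xs = set_encode ((\<lambda>y. tuple_type G k (xs @ [y])) ` (pverts G - set xs))"

lemma atomic_code_less: "atomic_code G xs < 2 ^ triangle (length xs - 1)"
  unfolding atomic_code_def
proof (rule set_encode_less, clarsimp)
  fix i j assume "Suc (i + j) < length xs"
  then have "triangle (Suc (i + j)) \<le> triangle (length xs - Suc 0)" by (intro triangle_mono) simp
  then show "prod_encode (i, j) < triangle (length xs - Suc 0)" by (simp add: prod_encode_def)
qed

lemma finite_atomic_code:
  "finite {prod_encode (i, j) | i j. Suc (i + j) < length xs \<and> (xs ! i, xs ! Suc (i + j)) \<in> parcs G}"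
  by (rule finite_subset[of _ "prod_encode ` ({..<length xs} \<times> {..<length xs})"]) auto

lemma atomic_code_eqD:
  assumes eq: "atomic_code G xs = atomic_code G zs" and len: "length xs = length zs"
    and G: "simple_graph G" and "i < length xs" "j < length xs"
  shows "(xs ! i, xs ! j) \<in> parcs G \<longleftrightarrow> (zs ! i, zs ! j) \<in> parcs G"
proof -
  have sym: "sym (parcs G)" and irr: "irrefl (parcs G)" using G by (auto simp: simple_graph_iff)
  have *: "(xs ! a, xs ! b) \<in> parcs G \<longleftrightarrow> (zs ! a, zs ! b) \<in> parcs G" if "a < b" "b < length xs" for a b
  proof -
    define A where "A ys = {prod_encode (i, j) | i j. Suc (i + j) < length ys \<and>
        (ys ! i, ys ! Suc (i + j)) \<in> parcs G}" for ys
    have "A xs = A zs"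
      using eq unfolding atomic_code_def A_def
      by (simp only: set_encode_eq[OF finite_atomic_code finite_atomic_code])
    moreover have "prod_encode (a, b - Suc a) \<in> A ys \<longleftrightarrow> (ys ! a, ys ! b) \<in> parcs G"
      if "length ys = length xs" for ys
      using \<open>a < b\<close> \<open>b < length xs\<close> that by (auto simp: A_def)
    ultimately show ?thesis using len by metis
  qed
  \<comment> \<open>Only increasing pairs are coded; irreflexivity and symmetry supply the
    others.\<close>
  consider "i < j" | "i = j" | "j < i" by linarith
  then show ?thesis
  proof cases
    case 3
    then show ?thesis using *[of j i] assms(4) symD[OF sym] by blast
  qed (use * assms(5) irr in \<open>auto simp: irrefl_def\<close>)
qed

text \<open>Tuples of equal type have extensions of equal type, so both can be prolonged until the
  adjacency codes are reached. Prolonging leaves the positions \<open>i\<close> and \<open>j\<close>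
  untouched.\<close>

lemma tuple_type_eqD:
  assumes "tuple_type G k xs = tuple_type G k zs" "length xs = length zs" "simple_graph G"
    "length xs + k \<le> card (pverts G)" "i < length xs" "j < length xs"
  shows "(xs ! i, xs ! j) \<in> parcs G \<longleftrightarrow> (zs ! i, zs ! j) \<in> parcs G"
  using assms
proof (induction k arbitrary: xs zs)
  case 0
  then have "atomic_code G xs = atomic_code G zs" by simp
  then show ?case by (rule atomic_code_eqD[OF _ 0(2,3,5,6)])
next
  case (Suc k)
  have fin: "finite (pverts G)" using Suc.prems by (simp add: simple_graph_iff)
  have "card (set xs) < card (pverts G)" using Suc.prems(4) card_length[of xs] by linarith
  then have "\<not> pverts G \<subseteq> set xs" using card_mono[of "set xs" "pverts G"] by force
  then obtain y where y: "y \<in> pverts G - set xs" by blast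
  have "(\<lambda>y. tuple_type G k (xs @ [y])) ` (pverts G - set xs) =
      (\<lambda>y. tuple_type G k (zs @ [y])) ` (pverts G - set zs)"
    using Suc.prems(1) fin by (simp add: set_encode_eq)
  then obtain z where "tuple_type G k (xs @ [y]) = tuple_type G k (zs @ [z])"
    using y by blast
  from Suc.IH[OF this] Suc.prems show ?case by (simp add: nth_append)
qed

text \<open>
  The choice operator picks an extension of each type; the predicate is satisfiable for the types
  over which the union is taken.
\<close>

primrec witnesses :: "nat pair_pre_digraph \<Rightarrow> nat \<Rightarrow> nat list \<Rightarrow> nat set" where
  "witnesses G 0 xs = {}"
| "witnesses G (Suc k) xs =
    (\<Union>y\<in>(\<lambda>c. SOME y. y \<in> pverts G - set xs \<and> tuple_type G k (xs @ [y]) = c) `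
       (\<lambda>y. tuple_type G k (xs @ [y])) ` (pverts G - set xs).
      insert y (witnesses G k (xs @ [y])))"

lemma witnesses_ex:
  assumes "y \<in> pverts G - set xs"
  shows "\<exists>z \<in> pverts G - set xs. tuple_type G k (xs @ [z]) = tuple_type G k (xs @ [y]) \<and>
    insert z (witnesses G k (xs @ [z])) \<subseteq> witnesses G (Suc k) xs"
proof -
  let ?z = "SOME z. z \<in> pverts G - set xs \<and> tuple_type G k (xs @ [z]) = tuple_type G k (xs @ [y])"
  have "?z \<in> pverts G - set xs \<and> tuple_type G k (xs @ [?z]) = tuple_type G k (xs @ [y])"
    by (rule someI[of _ y]) (use assms in simp)
  then show ?thesis using assms by (intro bexI[of _ ?z]) auto
qed

lemma witnesses_subset: "witnesses G k xs \<subseteq> pverts G"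
proof (induction k arbitrary: xs)
  case (Suc k)
  have "(SOME z. z \<in> pverts G - set xs \<and> tuple_type G k (xs @ [z]) = tuple_type G k (xs @ [y])) \<in> pverts G - set xs"
    if "y \<in> pverts G - set xs" for y
    using someI[of "\<lambda>z. z \<in> pverts G - set xs \<and> tuple_type G k (xs @ [z]) = tuple_type G k (xs @ [y])" y] that
    by blast
  then show ?case using Suc by fastforce
qed simp

text \<open>Here \<open>d\<close> is the final length of the tuples and \<open>k\<close> the number
  of places still open, so that \<open>length xs + k = d\<close> throughout.\<close>

primrec type_bound :: "nat \<Rightarrow> nat \<Rightarrow> nat" where
  "type_bound d 0 = 2 ^ triangle (d - 1)"
| "type_bound d (Suc k) = 2 ^ type_bound d k"

primrec witness_bound :: "nat \<Rightarrow> nat \<Rightarrow> nat" where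
  "witness_bound d 0 = 0"
| "witness_bound d (Suc k) = type_bound d k * Suc (witness_bound d k)"

lemma tuple_type_less: "length xs + k = d \<Longrightarrow> tuple_type G k xs < type_bound d k"
proof (induction k arbitrary: xs)
  case 0
  then show ?case using atomic_code_less[of G xs] by simp
next
  case (Suc k)
  then show ?case by (auto intro!: set_encode_less)
qed

lemma card_witnesses:
  assumes "finite (pverts G)"
  shows "length xs + k = d \<Longrightarrow> card (witnesses G k xs) \<le> witness_bound d k"
proof (induction k arbitrary: xs)
  case (Suc k)
  let ?Y = "(\<lambda>c. SOME y. y \<in> pverts G - set xs \<and> tuple_type G k (xs @ [y]) = c) `
       (\<lambda>y. tuple_type G k (xs @ [y])) ` (pverts G - set xs)"
  have fin: "finite ?Y" using assms by simp
  have "(\<lambda>y. tuple_type G k (xs @ [y])) ` (pverts G - set xs) \<subseteq> {..<type_bound d k}"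
    using Suc.prems by (auto intro!: tuple_type_less)
  then have "card ((\<lambda>y. tuple_type G k (xs @ [y])) ` (pverts G - set xs)) \<le> type_bound d k"
    using card_mono[of "{..<type_bound d k}"] by simp
  then have Y: "card ?Y \<le> type_bound d k"
    using card_image_le assms by (meson finite_Diff finite_imageI le_trans)
  have "card (witnesses G (Suc k) xs) \<le> (\<Sum>y\<in>?Y. card (insert y (witnesses G k (xs @ [y]))))"
    unfolding witnesses.simps by (rule card_UN_le[OF fin])
  also have "\<dots> \<le> (\<Sum>y\<in>?Y. Suc (witness_bound d k))"
  proof (rule sum_mono)
    fix y
    have "card (witnesses G k (xs @ [y])) \<le> witness_bound d k" using Suc.prems by (intro Suc.IH) simp
    then show "card (insert y (witnesses G k (xs @ [y]))) \<le> Suc (witness_bound d k)"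
      using card_insert_le_m1[of "Suc (witness_bound d k)"] by simp
  qed
  also have "\<dots> \<le> type_bound d k * Suc (witness_bound d k)"
    using mult_le_mono1[OF Y, of "Suc (witness_bound d k)"] by simp
  finally show ?case by simp
qed simp

section \<open>Transfer of sentences to the subgraph induced by the witnesses\<close>

definition induced :: "nat pair_pre_digraph \<Rightarrow> nat set \<Rightarrow> nat pair_pre_digraph" where
  "induced G W = \<lparr>pverts = W, parcs = parcs G \<inter> W \<times> W\<rparr>"

lemma induced_simps [simp]:
  "pverts (induced G W) = W"
  "parcs (induced G W) = parcs G \<inter> W \<times> W"
  by (auto simp: induced_def)

lemma simple_graph_induced:
  "simple_graph G \<Longrightarrow> W \<subseteq> pverts G \<Longrightarrow> W \<noteq> {} \<Longrightarrow> simple_graph (induced G W)"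
  by (auto simp: simple_graph_iff sym_def irrefl_def finite_subset)

text \<open>Applied to duals: by contraposition, universal sentences pass from \<open>G\<close> to
  induced subgraphs.\<close>

lemma existential_induced_upward:
  assumes "existential \<phi>" "W \<subseteq> pverts G" "\<And>x. x \<in> free_vars \<phi> \<Longrightarrow> e x \<in> W"
    "sat (induced G W) e \<phi>"
  shows "sat G e \<phi>"
  using assms
proof (induction \<phi> arbitrary: e)
  case (ExQ x \<phi>)
  then obtain v where v: "v \<in> W" "sat (induced G W) (e(x := v)) \<phi>" by auto
  have "sat G (e(x := v)) \<phi>"
    by (rule ExQ.IH[OF _ ExQ.prems(2) _ v(2)]) (use ExQ.prems v(1) in auto)
  then show ?case using ExQ.prems(2) v(1) by auto
qed auto

text \<open>An Ehrenfeucht game on two tuples of \<open>G\<close>: \<open>zs\<close> contains the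
  values of the free variables in \<open>G\<close>, \<open>xs\<close> the answers in
  \<open>W\<close>. Equal types with \<open>k\<close> open places let it continue for
  \<open>k\<close> new vertices, and distinctness turns equality of values into equality of
  positions.\<close>

lemma existential_induced_downward:
  assumes "existential \<phi>" "quantifier_depth \<phi> \<le> k" and G: "simple_graph G"
    and W: "W \<subseteq> pverts G" "set xs \<subseteq> W" "witnesses G k xs \<subseteq> W"
    and "length xs = length zs" "distinct xs" "distinct zs" "length xs + k \<le> card (pverts G)"
    and "tuple_type G k xs = tuple_type G k zs"
    and "\<And>x. x \<in> free_vars \<phi> \<Longrightarrow> \<exists>i<length xs. e x = zs ! i \<and> e' x = xs ! i"
    and "sat G e \<phi>"
  shows "sat (induced G W) e' \<phi>"
  using assms(1,2,5-)
proof (induction \<phi> arbitrary: k xs zs e e')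
  case (Eq x y)
  then show ?case by (metis free_vars.simps(1) insertCI nth_eq_iff_index_eq sat.simps(1))
next
  case (Adj x y)
  obtain i j where ij: "i < length xs" "e x = zs ! i" "e' x = xs ! i"
    "j < length xs" "e y = zs ! j" "e' y = xs ! j"
    using Adj.prems(10)[of x] Adj.prems(10)[of y] by auto
  have "e' x \<in> W" "e' y \<in> W" using ij Adj.prems(3) by auto
  then show ?case
    using tuple_type_eqD[OF Adj.prems(9,5) G Adj.prems(8) ij(1,4)] ij Adj.prems(11) by simp
next
  case (Neg \<phi>)
  then consider x y where "\<phi> = Eq x y" | x y where "\<phi> = Adj x y" by auto
  then show ?case
  proof cases
    case (1 x y)
    obtain i j where ij: "i < length xs" "e x = zs ! i" "e' x = xs ! i"
      "j < length xs" "e y = zs ! j" "e' y = xs ! j"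
      using Neg.prems(10)[of x] Neg.prems(10)[of y] 1 by auto
    then show ?thesis using Neg.prems(5-7,11) 1 by (simp add: nth_eq_iff_index_eq)
  next
    case (2 x y)
    obtain i j where ij: "i < length xs" "e x = zs ! i" "e' x = xs ! i"
      "j < length xs" "e y = zs ! j" "e' y = xs ! j"
      using Neg.prems(10)[of x] Neg.prems(10)[of y] 2 by auto
    then show ?thesis
      using tuple_type_eqD[OF Neg.prems(9,5) G Neg.prems(8) ij(1,4)] Neg.prems(11) 2 by simp
  qed
next
  case (Conj \<phi> \<psi>)
  have "sat (induced G W) e' \<phi>"
    by (rule Conj.IH(1)[OF _ _ Conj.prems(3-9)]) (use Conj.prems in auto)
  moreover have "sat (induced G W) e' \<psi>"
    by (rule Conj.IH(2)[OF _ _ Conj.prems(3-9)]) (use Conj.prems in auto)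
  ultimately show ?case by simp
next
  case (Disj \<phi> \<psi>)
  have "sat (induced G W) e' \<phi>" if "sat G e \<phi>"
    by (rule Disj.IH(1)[OF _ _ Disj.prems(3-9) _ that]) (use Disj.prems in auto)
  moreover have "sat (induced G W) e' \<psi>" if "sat G e \<psi>"
    by (rule Disj.IH(2)[OF _ _ Disj.prems(3-9) _ that]) (use Disj.prems in auto)
  ultimately show ?case using Disj.prems(11) by auto
next
  case (ExQ x \<phi>)
  obtain v where v: "v \<in> pverts G" "sat G (e(x := v)) \<phi>" using ExQ.prems(11) by auto
  have ex: "existential \<phi>" using ExQ.prems(1) by simp
  show ?case
  proof (cases "v \<in> set zs")
    \<comment> \<open>A repeated value is answered by the same position. The depth drops while
      \<open>k\<close> stays, which is why \<open>k\<close> only bounds the depth.\<close>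
    case True
    then obtain i where i: "i < length xs" "v = zs ! i"
      using ExQ.prems(5) by (auto simp: in_set_conv_nth)
    have "sat (induced G W) (e'(x := xs ! i)) \<phi>"
    proof (rule ExQ.IH[OF ex _ ExQ.prems(3-9) _ v(2)])
      show "quantifier_depth \<phi> \<le> k" using ExQ.prems(2) by simp
      show "\<exists>j<length xs. (e(x := v)) y = zs ! j \<and> (e'(x := xs ! i)) y = xs ! j"
        if "y \<in> free_vars \<phi>" for y
        using ExQ.prems(10)[of y] that i by (cases "y = x") auto
    qed
    moreover have "xs ! i \<in> W" using i ExQ.prems(3) by auto
    ultimately show ?thesis by auto
  next
    case False
    obtain k' where k: "k = Suc k'" using ExQ.prems(2) by (cases k) auto
    have "finite (pverts G)" using G by (simp add: simple_graph_iff)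
    then have "(\<lambda>y. tuple_type G k' (xs @ [y])) ` (pverts G - set xs) =
        (\<lambda>y. tuple_type G k' (zs @ [y])) ` (pverts G - set zs)"
      using ExQ.prems(9) by (simp add: k set_encode_eq)
    then obtain y where y: "y \<in> pverts G - set xs"
      "tuple_type G k' (xs @ [y]) = tuple_type G k' (zs @ [v])"
      using v(1) False by (metis (no_types, lifting) DiffI imageE imageI)
    \<comment> \<open>The answer \<open>y\<close> given by the types may lie outside
      \<open>W\<close>. It is replaced by a witness \<open>u\<close> of the same type, whose own
      witnesses are in \<open>W\<close> as well.\<close>
    have "witnesses G (Suc k') xs \<subseteq> W" using ExQ.prems(4) k by (simp only:)
    then obtain u where u: "u \<in> pverts G - set xs"
      "tuple_type G k' (xs @ [u]) = tuple_type G k' (zs @ [v])"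
      "insert u (witnesses G k' (xs @ [u])) \<subseteq> W"
      using witnesses_ex[OF y(1), of k'] unfolding y(2) by (meson order_trans)
    have "sat (induced G W) (e'(x := u)) \<phi>"
    proof (rule ExQ.IH[OF ex _ _ _ _ _ _ _ u(2) _ v(2)])
      show "quantifier_depth \<phi> \<le> k'" using ExQ.prems(2) by (simp add: k)
      show "\<exists>j<length (xs @ [u]). (e(x := v)) y = (zs @ [v]) ! j \<and> (e'(x := u)) y = (xs @ [u]) ! j"
        if "y \<in> free_vars \<phi>" for y
      proof (cases "y = x")
        case True
        then show ?thesis using ExQ.prems(5) by (intro exI[of _ "length xs"]) (simp add: nth_append)
      next
        case ne: False
        then have "y \<in> free_vars (ExQ x \<phi>)" using that by simp
        then obtain j where "j < length xs" "e y = zs ! j" "e' y = xs ! j"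
          using ExQ.prems(10) by blast
        then show ?thesis using ne ExQ.prems(5) by (intro exI[of _ j]) (simp add: nth_append)
      qed
    qed (use u ExQ.prems False k in auto)
    then show ?thesis using u(3) by auto
  qed
qed auto

text \<open>A sentence is no literal, so induction through \<open>Conj\<close> and
  \<open>Disj\<close> ends at quantifiers. There the game starts from empty tuples for
  \<open>ExQ\<close>, and the dual is lifted back to \<open>G\<close> for
  \<open>AllQ\<close>.\<close>

lemma zero_alternating_induced:
  assumes "sentence \<phi>" "zero_alternating \<phi>" "quantifier_depth \<phi> \<le> d" "simple_graph G"
    "d \<le> card (pverts G)" "sat G e \<phi>"
  shows "sat (induced G (witnesses G d [])) e \<phi>"
  using assms(1-3,6)
proof (induction \<phi>)
  case (ExQ x \<phi>)
  then have "existential (ExQ x \<phi>)" using zero_alternating_ExQ_imp by simp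
  then show ?case
    by (rule existential_induced_downward[where k = d and xs = "[]" and zs = "[]" and e = e])
      (use ExQ.prems assms(4,5) witnesses_subset in \<open>auto simp: sentence_def\<close>)
next
  case (AllQ x \<phi>)
  have "\<not> sat (induced G (witnesses G d [])) e (dual (AllQ x \<phi>))"
  proof
    assume *: "sat (induced G (witnesses G d [])) e (dual (AllQ x \<phi>))"
    have "sat G e (dual (AllQ x \<phi>))"
      by (rule existential_induced_upward[OF _ witnesses_subset _ *])
        (use AllQ.prems zero_alternating_AllQ_imp in \<open>auto simp: sentence_def\<close>)
    then show False using AllQ.prems(4) by simp
  qed
  then show ?case by simp
qed (auto simp: sentence_def zero_alternating_def)

section \<open>Estimates of the bounds by towers\<close>

lemma Suc_cube_le_four_power: "b ^ 3 + 1 \<le> (2::nat) ^ (2 * b)"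
proof (induction b)
  case (Suc b)
  show ?case
  proof (cases "b \<le> 1")
    case True
    then consider "b = 0" | "b = 1" by linarith
    then show ?thesis by cases (auto simp: eval_nat_numeral)
  next
    case False
    then have "2 * b \<le> b * b" "2 * (b * b) \<le> b * b * b" by auto
    moreover have "2 * b \<le> q \<Longrightarrow> 2 * q \<le> p \<Longrightarrow> p + 3 * q + 3 * b + 1 + 1 \<le> 4 * (p + 1)" for p q :: nat
      by simp
    moreover have "Suc b ^ 3 = b * b * b + 3 * (b * b) + 3 * b + 1" "b ^ 3 = b * b * b"
      by (simp_all add: power3_eq_cube algebra_simps)
    ultimately have "Suc b ^ 3 + 1 \<le> 4 * (b ^ 3 + 1)" by presburger
    also have "\<dots> \<le> 4 * 2 ^ (2 * b)" using Suc by simp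
    finally show ?thesis by simp
  qed
qed simp

lemma type_bound_pos: "0 < type_bound d k"
  by (cases k) auto

text \<open>Counting witnesses instead of types costs only a power, not an exponential. With
  \<open>b = type_bound d k\<close>, the step is \<open>b * b^2 + 1 \<le> 2^(2 * b)\<close>, whose
  right side is the square of the next bound.\<close>

lemma Suc_witness_bound_le: "Suc (witness_bound d k) \<le> type_bound d k ^ 2"
proof (induction k)
  case (Suc k)
  have "Suc (witness_bound d (Suc k)) \<le> type_bound d k * type_bound d k ^ 2 + 1"
    using mult_le_mono2[OF Suc, of "type_bound d k"] by simp
  also have "\<dots> = type_bound d k ^ 3 + 1" by (simp add: power3_eq_cube power2_eq_square)
  also have "\<dots> \<le> type_bound d (Suc k) ^ 2" 
    by (metis Suc_cube_le_four_power type_bound.simps(2) power_mult mult.commute)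
  finally show ?case .
qed simp

lemma triangle_less_power: "triangle k < 2 ^ k"
proof (induction k)
  case (Suc k)
  have "Suc k \<le> 2 ^ k" using less_exp[of k] by (rule Suc_leI)
  then show ?case using Suc by simp
qed simp

text \<open>The factor 3 anticipates the cube of a type bound taken in
  \<open>witness_bound_le_tower\<close>. It survives the induction because
  \<open>3 * 2^b \<le> 2^(b + 2)\<close> and \<open>b + 2 \<le> 3 * b\<close> for positive
  \<open>b\<close>.\<close>

lemma type_bound_le_tower:
  assumes "2 \<le> d" "d \<le> tower r"
  shows "3 * type_bound d k \<le> tower (Suc (Suc r) + k)"
proof (induction k)
  case 0
  obtain c where c: "d = Suc c" "1 \<le> c" using assms(1) by (cases d) auto
  have "2 \<le> (2::nat) ^ c" using c(2) power_increasing[of 1 c "2::nat"] by simp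
  then have "triangle c + 2 \<le> 2 ^ d" using triangle_less_power[of c] c by simp
  also have "(2::nat) ^ d \<le> 2 ^ tower r" using assms(2) by (intro power_increasing) auto
  finally have "(2::nat) ^ (triangle c + 2) \<le> 2 ^ (2 ^ tower r)" by (intro power_increasing) auto
  then show ?case by (simp add: c power_add)
next
  case (Suc k)
  have "3 * type_bound d (Suc k) \<le> 2 ^ (type_bound d k + 2)" by (simp add: power_add)
  also have "\<dots> \<le> 2 ^ tower (Suc (Suc r) + k)"
    using Suc type_bound_pos[of d k] by (intro power_increasing) auto
  finally show ?case by simp
qed

text \<open>With \<open>d = k + 2\<close>, the last step of the witness recursion is polynomial, so
  \<open>k + 1\<close> exponentials are added to the \<open>r + 2\<close> that cover
  \<open>type_bound d 0\<close>.\<close>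

lemma witness_bound_le_tower:
  assumes "1 \<le> d" "d \<le> tower r"
  shows "witness_bound d d \<le> tower (Suc r + d)"
proof (cases "d = 1")
  case True
  then show ?thesis using tower_mono[of 0 "Suc r + d"] by simp
next
  case False
  then obtain k where k: "d = Suc (Suc k)" using assms(1) by (cases d; cases "d - 1") auto
  have "witness_bound d d \<le> type_bound d (Suc k) * type_bound d (Suc k) ^ 2"
    unfolding k witness_bound.simps(2)[of _ "Suc k"] by (intro mult_le_mono2 Suc_witness_bound_le)
  also have "\<dots> = type_bound d (Suc k) ^ 3" by (simp add: power3_eq_cube power2_eq_square)
  also have "\<dots> = 2 ^ (3 * type_bound d k)" by (simp add: power_mult[symmetric] mult.commute)
  also have "\<dots> \<le> 2 ^ tower (Suc (Suc r) + k)"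
    using type_bound_le_tower[of d r k] assms False by (intro power_increasing) auto
  also have "\<dots> = tower (Suc r + d)" by (simp add: k)
  finally show ?thesis .
qed

lemma quantifier_depth_sentence: "sentence \<phi> \<Longrightarrow> 1 \<le> quantifier_depth \<phi>"
  by (induction \<phi>) (auto simp: sentence_def)

lemma card_le_tower:
  assumes G: "simple_graph G" and "definable0 d G" "d \<le> tower r"
  shows "card (pverts G) \<le> tower (Suc r + d)"
proof (cases "d \<le> card (pverts G)")
  \<comment> \<open>With fewer than \<open>d\<close> vertices the claim is trivial; otherwise there
    are enough vertices for types to determine adjacencies.\<close>
  case False
  then show ?thesis using less_tower[of "Suc r + d"] by linarith
next
  case True
  obtain \<phi> where \<phi>: "sentence \<phi>" "zero_alternating \<phi>" "defines_graph \<phi> G" "quantifier_depth \<phi> \<le> d"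
    using assms(2) by (auto simp: definable0_def)
  have d: "1 \<le> d" using quantifier_depth_sentence[OF \<phi>(1)] \<phi>(4) by simp
  define W where "W = witnesses G d []"
  have fin: "finite (pverts G)" and ne: "pverts G \<noteq> {}" using G by (auto simp: simple_graph_iff)
  have "W \<noteq> {}" using d ne by (cases d) (auto simp: W_def)
  then have H: "simple_graph (induced G W)"
    using G witnesses_subset by (intro simple_graph_induced) (auto simp: W_def)
  have "sat G undefined \<phi>" using \<phi>(1,3) models_iff_sat[OF _ ne] by (simp add: defines_graph_def)
  then have "sat (induced G W) undefined \<phi>"
    unfolding W_def using zero_alternating_induced \<phi> G True by blast
  then have "models (induced G W) \<phi>" 
    using models_iff_sat[OF \<phi>(1), of "induced G W" undefined] \<open>W \<noteq> {}\<close> by simp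
  then have "digraph_iso (with_proj (induced G W)) (with_proj G)"
    using \<phi>(3) H by (auto simp: defines_graph_def)
  then have "card (pverts G) = card W" using card_pverts_digraph_iso by fastforce
  also have "\<dots> \<le> witness_bound d d" unfolding W_def by (rule card_witnesses[OF fin]) simp
  also have "\<dots> \<le> tower (Suc r + d)" by (rule witness_bound_le_tower[OF d assms(3)])
  finally show ?thesis .
qed

lemma q0_lower:
  assumes "1 \<le> n"
  shows "log_star (real n) \<le> q0 n + log_star (real (log_star (real n))) + 1"
proof (cases "q0 n \<le> log_star (real n)")
  case True
  \<comment> \<open>As \<open>n\<close> is positive, a graph of order \<open>n\<close> exists, so
    the minimum in \<open>q0\<close> is attained.\<close>
  have "\<exists>d G. simple_graph G \<and> card (pverts G) = n \<and> D0 G = d"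
    using simple_graph_layered[of n] assms by (intro exI[of _ "layered_graph n"] exI) auto
  then have "\<exists>G. simple_graph G \<and> card (pverts G) = n \<and> D0 G = q0 n"
    unfolding q0_def by (rule LeastI_ex)
  then obtain G where G: "simple_graph G" "card (pverts G) = n" "D0 G = q0 n" by blast
  have def: "definable0 (q0 n) G" using definable0_D0[OF definable0_card[OF G(1)]] G(3) by simp
  \<comment> \<open>With this \<open>r\<close> the assumption
    \<open>q0 n \<le> log_star (real n)\<close> yields \<open>q0 n \<le> tower r\<close>; without
    that assumption the claim is immediate.\<close>
  define r where "r = log_star (real (log_star (real n)))"
  have "log_star (real n) \<le> tower r"
    using log_star_le_iff[of "real (log_star (real n))" r] by (simp add: r_def)
  then have "q0 n \<le> tower r" using True by simp
  then have "n \<le> tower (Suc r + q0 n)" using card_le_tower[OF G(1) def] G(2) by simp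
  then have "log_star (real n) \<le> Suc r + q0 n" unfolding log_star_le_iff by simp
  then show ?thesis by (simp add: r_def)
qed simp

theorem theorem1:
  fixes n :: nat
  assumes "n \<ge> 1"
  shows "int (log_star (real n)) - int (log_star (real (log_star (real n)))) - 1 \<le> int (q0 n)
    \<and> int (q0 n) \<le> int (log_star (real n)) + 22"
  using q0_lower[OF assms] q0_upper[OF assms] by linarith

end
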